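(* Let $p\ge3$ be a prime, and let $f\colon\mathbb F_p^2\to\mathbb C$ be a nonzero function. Write $S:=\operatorname{supp} f\subseteq\mathbb F_p^2$ and $X:=\operatorname{supp}\hat f\subseteq\widehat{\mathbb F_p^2}$. Then $$\frac1{p-1}\,\min\{|S|,|X|\}+\frac12\,\max\{|S|,|X|\}\ge p+1,$$ except if $S$ and $X$ are cosets of a pair of nonzero, proper, mutually orthogonal subgroups of $\mathbb F_p^2$ and $\widehat{\mathbb F_p^2}$, respectively (that is, there is a nonzero, proper subgroup $H<\mathbb F_p^2$ such that $S$ is a coset of $H$ and $X$ is a coset of $H^\perp$).
   Context: $\mathbb F_p^2$ is regarded as an additive group $G$; $\widehat G$ is its group of complex characters. For $f\colon G\to\mathbb C$, the Fourier transform $\hat f\colon\widehat G\to\mathbb C$ is $\hat f(\chi)=\frac1{|G|}\sum_{g\in G}f(g)\overline{\chi(g)}$. For a subgroup $H\le G$, $H^\perp:=\{\chi\in\widehat G\colon H\le\ker\chi\}$; the subgroups $H$ and $H^\perp$ are called orthogonal to each other. The support $\operatorname{supp}$ of a function is the set of points where it is nonzero. *)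

theory Defs
  imports "HOL-Analysis.Analysis" "HOL-Algebra.Coset" "HOL-Number_Theory.Residues"
begin

definition complex_units :: "complex monoid" where
  "complex_units = \<lparr>carrier = UNIV - {0}, mult = (*), one = 1\<rparr>"

text \<open>
  Characters of a finite group are its homomorphisms into the nonzero complex numbers (their
  values are automatically roots of unity). Restricting to extensional functions makes two
  characters equal as soon as they agree on the carrier.
\<close>

definition dual_group :: "('a, 'm) monoid_scheme \<Rightarrow> ('a \<Rightarrow> complex) monoid" where
  "dual_group G =
    \<lparr>carrier = hom G complex_units \<inter> extensional (carrier G),
     mult = (\<lambda>\<psi> \<phi>. \<lambda>g\<in>carrier G. \<psi> g * \<phi> g),
     one = (\<lambda>g\<in>carrier G. 1)\<rparr>"

definition fourier :: "('a, 'm) monoid_scheme \<Rightarrow> ('a \<Rightarrow> complex) \<Rightarrow> ('a \<Rightarrow> complex) \<Rightarrow> complex" where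
  "fourier G f \<psi> = 1 / of_nat (order G) * (\<Sum>g\<in>carrier G. f g * cnj (\<psi> g))"

definition annihilator :: "('a, 'm) monoid_scheme \<Rightarrow> 'a set \<Rightarrow> ('a \<Rightarrow> complex) set" where
  "annihilator G H = {\<psi> \<in> carrier (dual_group G). H \<subseteq> kernel G complex_units \<psi>}"

definition Fp2 :: "nat \<Rightarrow> (int \<times> int) monoid" where
  "Fp2 p = add_monoid (residue_ring (int p)) \<times>\<times> add_monoid (residue_ring (int p))"

lemma comm_group_dual_group:
  assumes "group G"
  shows "comm_group (dual_group G)"
proof -
  interpret G: group G by fact
  have inverse: "\<exists>\<phi>\<in>carrier (dual_group G). \<phi> \<otimes>\<^bsub>dual_group G\<^esub> \<psi> = \<one>\<^bsub>dual_group G\<^esub>"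
    if "\<psi> \<in> carrier (dual_group G)" for \<psi>
    by (rule bexI[of _ "\<lambda>g\<in>carrier G. inverse (\<psi> g)"])
      (use that in \<open>auto simp: dual_group_def complex_units_def hom_def fun_eq_iff Pi_iff\<close>)
  show ?thesis
    by (rule comm_groupI; (rule inverse)?)
      (auto simp: dual_group_def complex_units_def hom_def Pi_iff extensional_def fun_eq_iff)
qed

lemma subgroup_annihilator:
  assumes "group G" and "H \<subseteq> carrier G"
  shows "subgroup (annihilator G H) (dual_group G)"
proof -
  interpret G: group G by fact
  interpret D: comm_group "dual_group G" by (rule comm_group_dual_group) fact
  have inv_eq: "inv\<^bsub>dual_group G\<^esub> \<psi> = (\<lambda>g\<in>carrier G. inverse (\<psi> g))"
    if "\<psi> \<in> carrier (dual_group G)" for \<psi>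
    by (rule D.inv_equality)
      (use that in \<open>auto simp: dual_group_def complex_units_def hom_def fun_eq_iff Pi_iff\<close>)
  have mem: "\<psi> \<in> annihilator G H \<longleftrightarrow> \<psi> \<in> carrier (dual_group G) \<and> (\<forall>g\<in>H. \<psi> g = 1)" for \<psi>
    using assms(2) by (auto simp: annihilator_def kernel_def complex_units_def)
  show ?thesis
  proof
    show "annihilator G H \<subseteq> carrier (dual_group G)"
      by (auto simp: mem)
    show "\<one>\<^bsub>dual_group G\<^esub> \<in> annihilator G H"
      using D.one_closed assms(2) by (auto simp: mem) (auto simp: dual_group_def)
    show "\<psi> \<otimes>\<^bsub>dual_group G\<^esub> \<phi> \<in> annihilator G H"
      if "\<psi> \<in> annihilator G H" "\<phi> \<in> annihilator G H" for \<psi> \<phi>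
      using that assms(2) D.m_closed[of \<psi> \<phi>] by (auto simp: mem) (auto simp: dual_group_def)
    show "inv\<^bsub>dual_group G\<^esub> \<psi> \<in> annihilator G H" if "\<psi> \<in> annihilator G H" for \<psi>
      using that assms(2) D.inv_closed[of \<psi>] inv_eq[of \<psi>] by (auto simp: mem subset_iff)
  qed
qed

lemma comm_group_Fp2:
  assumes "prime p"
  shows "comm_group (Fp2 p)"
proof -
  have "1 < int p"
    using assms prime_gt_1_nat[of p] by simp
  then interpret residues "int p" "residue_ring (int p)"
    by unfold_locales simp_all
  have "group (Fp2 p)"
    unfolding Fp2_def by (intro DirProd_group a_group)
  then show ?thesis
    by (rule group.group_comm_groupI) (auto simp: Fp2_def a_comm)
qed

end

theory Submission
  imports Defs
begin

text \<open>
  For a line direction in the plane let \<open>n\<close> be the number of parallel lines of that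
  direction meeting \<open>S\<close>, and let \<open>k\<close> be the number of parallel lines of the orthogonal
  direction meeting \<open>X\<close>. Transforming in one coordinate at a time, and using on each line
  the uncertainty principle \<open>|supp g| + |supp \<hat>g| \<ge> p + 1\<close> for the
  cyclic group of prime order \<open>p\<close>, one gets
  \<open>|S| \<ge> n (p + 1 - k)\<close> and \<open>|X| \<ge> k (p + 1 - n)\<close> (\<open>direction_count_bounds\<close>). If the
  asserted inequality fails, these two bounds leave only \<open>n = k = 1\<close> and \<open>n = k = p\<close>, and
  moreover \<open>|S| + |X| < 4 (p - 1)\<close> (\<open>direction_dichotomy\<close>). If \<open>n = k = 1\<close> for some direction,
  then \<open>S\<close> and \<open>X\<close> lie on lines of orthogonal directions and have at least \<open>p\<close> points each, so
  they are whole lines: this is the exceptional case. Otherwise \<open>n = k = p\<close> for every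
  direction, so \<open>S\<close> and \<open>X\<close> meet all lines of their planes. A set meeting all lines of the affine
  plane of order \<open>p\<close> has at least \<open>2 p - 1\<close> points, by the theorem of Jamison and of Brouwer
  and Schrijver (\<open>affine_blocking_set_card\<close>), and \<open>4 p - 2 > 4 (p - 1)\<close> is a contradiction.

  The uncertainty principle for prime cyclic groups says that a nonzero complex polynomial of
  degree below \<open>p\<close> has fewer zeros among the \<open>p\<close>-th roots of unity than it has terms
  (\<open>sparse_poly_roots_of_unity\<close>). Choose a valuation ring of the complex numbers whose maximal
  ideal contains \<open>p\<close>, and scale the polynomial so that its coefficients lie in the ring and one
  of them is \<open>1\<close>. All \<open>p\<close>-th roots of unity are congruent to \<open>1\<close>, so with \<open>k\<close> terms and \<open>k\<close> zeros
  the polynomial is divisible by \<open>(x - 1)\<^sup>k\<close> modulo the maximal ideal. In characteristic \<open>p\<close> this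
  forces a polynomial of degree below \<open>p\<close> with at most \<open>k\<close> terms to vanish.
\<close>

section \<open>Polynomials over a subring of a field\<close>

text \<open>The short names \<open>coeff\<close>, \<open>monom\<close> and \<open>smult\<close> refer to the type constructor \<open>poly\<close>.\<close>

hide_const (open) up_ring.coeff up_ring.monom module.smult

text \<open>Subrings (with one) of a field, as sets.\<close>

definition subring_set :: "'a::field set \<Rightarrow> bool" where
  "subring_set A \<longleftrightarrow> 1 \<in> A \<and> (\<forall>x\<in>A. \<forall>y\<in>A. x - y \<in> A \<and> x * y \<in> A)"

text \<open>Polynomials all of whose coefficients lie in \<open>A\<close>; here \<open>A\<close> is a subring or an ideal.\<close>

definition poly_over :: "'a::zero set \<Rightarrow> 'a poly set" where
  "poly_over A = {q. \<forall>i. coeff q i \<in> A}"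

context
  fixes A :: "'a::field set"
  assumes A: "subring_set A"
begin

lemma subring_diff: "x \<in> A \<Longrightarrow> y \<in> A \<Longrightarrow> x - y \<in> A"
  and subring_mult: "x \<in> A \<Longrightarrow> y \<in> A \<Longrightarrow> x * y \<in> A"
  and subring_1: "1 \<in> A"
  using A by (auto simp: subring_set_def)

lemma subring_0: "0 \<in> A"
  using subring_diff[OF subring_1 subring_1] by simp

lemma subring_minus: "x \<in> A \<Longrightarrow> - x \<in> A"
  using subring_diff[OF subring_0, of x] by simp

lemma subring_add: "x \<in> A \<Longrightarrow> y \<in> A \<Longrightarrow> x + y \<in> A"
  using subring_diff[OF _ subring_minus[of y], of x] by simp

lemma subring_sum: "(\<And>i. i \<in> I \<Longrightarrow> f i \<in> A) \<Longrightarrow> sum f I \<in> A"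
  by (induction I rule: infinite_finite_induct) (auto intro: subring_add subring_0)

lemma subring_power: "x \<in> A \<Longrightarrow> x ^ n \<in> A"
  by (induction n) (auto intro: subring_mult subring_1)

lemma subring_of_nat: "of_nat n \<in> A"
  by (induction n) (auto intro: subring_add subring_0 subring_1)

lemma subring_of_int: "of_int k \<in> A"
  by (cases k) (auto intro: subring_minus subring_of_nat simp del: of_nat_Suc)

lemma poly_over_simps:
  shows poly_over_0: "0 \<in> poly_over A"
    and poly_over_diff: "P \<in> poly_over A \<Longrightarrow> Q \<in> poly_over A \<Longrightarrow> P - Q \<in> poly_over A"
    and poly_over_add: "P \<in> poly_over A \<Longrightarrow> Q \<in> poly_over A \<Longrightarrow> P + Q \<in> poly_over A"
    and poly_over_mult: "P \<in> poly_over A \<Longrightarrow> Q \<in> poly_over A \<Longrightarrow> P * Q \<in> poly_over A"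
    and poly_over_monom: "c \<in> A \<Longrightarrow> monom c n \<in> poly_over A"
    and poly_over_pCons: "c \<in> A \<Longrightarrow> P \<in> poly_over A \<Longrightarrow> pCons c P \<in> poly_over A"
  by (auto simp: poly_over_def coeff_mult coeff_pCons subring_0
      intro!: subring_diff subring_add subring_mult subring_sum split: nat.splits)

lemma poly_over_sum: "(\<And>i. i \<in> I \<Longrightarrow> f i \<in> poly_over A) \<Longrightarrow> sum f I \<in> poly_over A"
  by (auto simp: poly_over_def coeff_sum intro!: subring_sum)

lemma poly_over_1: "1 \<in> poly_over A"
  unfolding one_pCons by (intro poly_over_pCons subring_1 poly_over_0)

lemma poly_over_power: "P \<in> poly_over A \<Longrightarrow> P ^ n \<in> poly_over A"
  by (induction n) (auto intro: poly_over_mult poly_over_1)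

lemma poly_over_pderiv: "P \<in> poly_over A \<Longrightarrow> pderiv P \<in> poly_over A"
  by (auto simp: poly_over_def coeff_pderiv simp del: of_nat_Suc
      intro!: subring_mult subring_of_nat)

lemma subring_adjoin: "subring_set ((\<lambda>q. poly q x) ` poly_over A)"
  unfolding subring_set_def
proof safe
  show "1 \<in> (\<lambda>q. poly q x) ` poly_over A"
    by (rule image_eqI[of _ _ 1]) (auto intro: poly_over_1)
next
  fix q r assume "q \<in> poly_over A" "r \<in> poly_over A"
  then show "poly q x - poly r x \<in> (\<lambda>q. poly q x) ` poly_over A"
    and "poly q x * poly r x \<in> (\<lambda>q. poly q x) ` poly_over A"
    by (auto intro: image_eqI[of _ _ "q - r"] image_eqI[of _ _ "q * r"] poly_over_diff poly_over_mult)
qed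

text \<open>Division by a monic linear polynomial does not leave the subring: the coefficients of the
  quotient are determined from the leading one downwards.\<close>

lemma poly_over_cofactor:
  assumes "P \<in> poly_over A" "z \<in> A" "P = [:- z, 1:] * h"
  shows "h \<in> poly_over A"
proof -
  \<comment> \<open>descending induction on the index, starting above the degree\<close>
  have "coeff h (degree h + 1 - n) \<in> A" for n
  proof (induction n)
    case 0
    then show ?case by (simp add: coeff_eq_0 subring_0)
  next
    case (Suc n)
    show ?case
    proof (cases "n \<le> degree h")
      case True
      define i where "i = degree h - n"
      have i: "degree h + 1 - Suc n = i" "degree h + 1 - n = Suc i" using True by (auto simp: i_def)
      have "coeff h i = coeff P (Suc i) + z * coeff h (Suc i)"
        by (simp add: assms(3))
      moreover have "coeff P (Suc i) \<in> A" using assms(1) by (simp add: poly_over_def)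
      moreover have "z * coeff h (Suc i) \<in> A"
        by (rule subring_mult[OF assms(2)]) (use Suc i(2) in metis)
      ultimately have "coeff h i \<in> A" by (metis subring_add)
      then show ?thesis by (metis i(1))
    next
      case False
      then show ?thesis using Suc by simp
    qed
  qed
  note * = this
  have "coeff h i \<in> A" for i
  proof (cases "i \<le> degree h")
    case True
    then have "degree h + 1 - (degree h + 1 - i) = i" by simp
    then show ?thesis using *[of "degree h + 1 - i"] by (simp only:)
  next
    case False
    then show ?thesis by (simp add: coeff_eq_0 subring_0)
  qed
  then show ?thesis by (simp add: poly_over_def)
qed

lemma poly_over_factor_roots:
  assumes "finite J" "J \<subseteq> A" "P \<in> poly_over A" "\<And>z. z \<in> J \<Longrightarrow> poly P z = 0"
  shows "\<exists>h\<in>poly_over A. P = (\<Prod>z\<in>J. [:- z, 1:]) * h"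
  using assms
proof (induction J arbitrary: P rule: finite_induct)
  case empty
  then show ?case by auto
next
  case (insert z J)
  obtain h where h: "P = [:- z, 1:] * h"
    using insert.prems(3)[of z] by (auto simp: poly_eq_0_iff_dvd elim: dvdE)
  have hA: "h \<in> poly_over A"
    by (rule poly_over_cofactor[OF _ _ h]) (use insert.prems in auto)
  have "poly h y = 0" if "y \<in> J" for y
  proof -
    have "y \<noteq> z" using that insert.hyps by auto
    with insert.prems(3)[of y] that show ?thesis by (auto simp: h)
  qed
  with insert.IH[of h] hA insert.prems obtain k
    where k: "k \<in> poly_over A" "h = (\<Prod>z\<in>J. [:- z, 1:]) * k" by auto
  have "P = (\<Prod>z\<in>insert z J. [:- z, 1:]) * k"
    unfolding prod.insert[OF insert.hyps] mult.assoc k(2)[symmetric] by (rule h)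
  with k(1) show ?case by blast
qed

end

section \<open>Existence of valuation rings\<close>

text \<open>
  The heart of Chevalley's extension theorem. Let \<open>A\<close> be maximal among the subrings without
  \<open>1/\<pi>\<close>, so that adjoining any further element \<open>z\<close> yields a relation \<open>\<pi> q(z) = 1\<close> over \<open>A\<close>.
  If both \<open>x\<close> and \<open>y = 1/x\<close> satisfied such relations, the one for \<open>y\<close> could be used to lower the
  degree of a minimal one for \<open>x\<close>.
\<close>

lemma maximal_subring_step:
  fixes A :: "'a::field set"
  assumes A: "subring_set A" and pi: "\<pi> \<in> A" "\<pi> \<noteq> 0" "inverse \<pi> \<notin> A"
    and max: "\<And>z. z \<notin> A \<Longrightarrow> \<exists>q\<in>poly_over A. \<pi> * poly q z = 1"
    and xy: "x * y = 1"
    and q: "q \<in> poly_over A" "\<pi> * poly q x = 1"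
    and qmin: "\<And>q'. q' \<in> poly_over A \<Longrightarrow> \<pi> * poly q' x = 1 \<Longrightarrow> degree q \<le> degree q'"
    and r: "r \<in> poly_over A" "\<pi> * poly r y = 1"
    and le: "degree r \<le> degree q"
  shows False
proof -
  note [intro] = subring_diff[OF A] subring_mult[OF A] subring_1[OF A] subring_0[OF A]
    subring_power[OF A] subring_sum[OF A] subring_add[OF A]
  have no_unit: "\<pi> * a \<noteq> 1" if "a \<in> A" for a
    using that pi by (metis inverse_unique)
  have rA: "coeff r i \<in> A" and qA: "coeff q i \<in> A" for i
    using r q by (auto simp: poly_over_def)
  define u where "u = 1 - \<pi> * coeff r 0"
  have u0: "u \<noteq> 0" using no_unit[of "coeff r 0"] rA by (auto simp: u_def)
  have uA: "u \<in> A" unfolding u_def using pi rA by auto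
  \<comment> \<open>otherwise a relation for \<open>1/u\<close>, multiplied by a power of \<open>u\<close>, would invert \<open>\<pi>\<close> in \<open>A\<close>\<close>
  have vA: "inverse u \<in> A"
  proof (rule ccontr)
    assume "inverse u \<notin> A"
    from max[OF this] obtain t where t: "t \<in> poly_over A" "\<pi> * poly t (inverse u) = 1" by auto
    define a where "a = (\<Sum>i\<le>degree t. coeff t i * u ^ (degree t - i))"
    have aA: "a \<in> A"
      unfolding a_def using t uA by (auto simp: poly_over_def)
    have "u ^ degree t * poly t (inverse u) = a"
      unfolding poly_altdef a_def sum_distrib_left
    proof (rule sum.cong, simp, goal_cases)
      case (1 i)
      then have "u ^ degree t = u ^ i * u ^ (degree t - i)"
        by (simp flip: power_add)
      then show ?case
        using u0 by (simp add: power_inverse field_simps)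
    qed
    then have "u ^ degree t = \<pi> * a"
      using t(2) by (metis mult.left_commute mult.right_neutral)
    moreover have "\<exists>b\<in>A. u ^ n = 1 - \<pi> * b" for n
    proof (induction n)
      case 0
      then show ?case by (auto intro!: bexI[of _ 0])
    next
      case (Suc n)
      then obtain b where b: "b \<in> A" "u ^ n = 1 - \<pi> * b" by auto
      have "u ^ Suc n = (1 - \<pi> * coeff r 0) * (1 - \<pi> * b)"
        by (simp only: power_Suc b(2)) (simp add: u_def)
      also have "\<dots> = 1 - \<pi> * (coeff r 0 + b - \<pi> * coeff r 0 * b)"
        by (simp add: algebra_simps)
      finally have "u ^ Suc n = 1 - \<pi> * (coeff r 0 + b - \<pi> * coeff r 0 * b)" .
      moreover have "coeff r 0 + b - \<pi> * coeff r 0 * b \<in> A"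
        using b rA pi by auto
      ultimately show ?case by blast
    qed
    ultimately obtain b where "b \<in> A" "\<pi> * a = 1 - \<pi> * b" by metis
    then have "\<pi> * (a + b) = 1" "a + b \<in> A" using aA by (auto simp: algebra_simps)
    then show False using no_unit by blast
  qed
  define n where "n = degree q"
  define m where "m = degree r"
  have m1: "m \<ge> 1"
  proof (rule ccontr)
    assume "\<not> m \<ge> 1"
    then obtain c where "r = [:c:]" unfolding m_def by (metis degree_eq_zeroE less_one not_le)
    then show False using r no_unit[of c] rA[of 0] by simp
  qed
  have nm: "m \<le> n" using le by (simp add: n_def m_def)
  have split_r: "poly r y = coeff r 0 + (\<Sum>j=1..m. coeff r j * y ^ j)"
    unfolding poly_altdef m_def[symmetric] atMost_atLeast0
    by (subst sum.atLeast_Suc_atMost) auto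
  have "u = \<pi> * (\<Sum>j=1..m. coeff r j * y ^ j)"
    using r(2) unfolding split_r u_def by (simp add: algebra_simps)
  then have one: "1 = inverse u * \<pi> * (\<Sum>j=1..m. coeff r j * y ^ j)"
    using u0 by (metis left_inverse mult.assoc)
  have "x ^ n = inverse u * \<pi> * (\<Sum>j=1..m. coeff r j * (x ^ n * y ^ j))"
    by (subst mult_1_right[symmetric], subst one) (simp add: sum_distrib_left mult_ac)
  also have "(\<Sum>j=1..m. coeff r j * (x ^ n * y ^ j)) = (\<Sum>j=1..m. coeff r j * x ^ (n - j))"
  proof (rule sum.cong, simp, goal_cases)
    case (1 j)
    then have "x ^ n = x ^ (n - j) * x ^ j" using nm by (simp flip: power_add)
    then show ?case using xy by (simp add: mult.assoc flip: power_mult_distrib)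
  qed
  finally have xn: "x ^ n = inverse u * \<pi> * (\<Sum>j=1..m. coeff r j * x ^ (n - j))" .
  \<comment> \<open>the top monomial of \<open>q\<close> is replaced by means of the relation \<open>xn\<close>\<close>
  define q' where "q' = (\<Sum>i<n. monom (coeff q i) i)
      + (\<Sum>j=1..m. monom (coeff q n * (inverse u * \<pi> * coeff r j)) (n - j))"
  have "q' \<in> poly_over A"
    unfolding q'_def
    by (intro poly_over_add[OF A] poly_over_sum[OF A] poly_over_monom[OF A])
      (use qA rA vA pi in auto)
  moreover have "poly q' x = poly q x"
  proof -
    have "poly q x = (\<Sum>i<n. coeff q i * x ^ i) + coeff q n * x ^ n"
      unfolding poly_altdef n_def[symmetric] by (simp flip: lessThan_Suc_atMost)
    then show ?thesis
      unfolding q'_def by (subst (asm) xn) (simp add: poly_sum poly_monom sum_distrib_left mult_ac)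
  qed
  moreover have "degree q' \<le> n - 1"
    unfolding q'_def
    by (intro degree_add_le degree_sum_le) (auto intro: order.trans[OF degree_monom_le])
  ultimately show False
    using qmin[of q'] q(2) m1 nm by (simp add: n_def)
qed

text \<open>Chevalley: a subring containing \<open>\<pi>\<close> but not \<open>1/\<pi>\<close> extends to a
  valuation ring not containing \<open>1/\<pi>\<close>.\<close>
theorem ex_valuation_ring:
  fixes A\<^sub>0 :: "'a::field set"
  assumes "subring_set A\<^sub>0" "\<pi> \<in> A\<^sub>0" "\<pi> \<noteq> 0" "inverse \<pi> \<notin> A\<^sub>0"
  obtains A where "subring_set A" "A\<^sub>0 \<subseteq> A" "inverse \<pi> \<notin> A" "\<And>x. x \<in> A \<or> inverse x \<in> A"
proof -
  define \<A> where "\<A> = {A. subring_set A \<and> A\<^sub>0 \<subseteq> A \<and> inverse \<pi> \<notin> A}"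
  have "\<exists>M\<in>\<A>. \<forall>B\<in>\<A>. M \<subseteq> B \<longrightarrow> B = M"
  proof (rule subset_Zorn_nonempty)
    show "\<A> \<noteq> {}" using assms by (auto simp: \<A>_def)
    fix C assume C: "C \<noteq> {}" "subset.chain \<A> C"
    then have Cin: "B \<in> \<A>" if "B \<in> C" for B using that by (auto simp: subset.chain_def)
    have closed: "x - y \<in> \<Union>C \<and> x * y \<in> \<Union>C" if xy: "x \<in> \<Union>C" "y \<in> \<Union>C" for x y
    proof -
      obtain B1 B2 where B: "B1 \<in> C" "x \<in> B1" "B2 \<in> C" "y \<in> B2" using xy by auto
      have "B1 \<subseteq> B2 \<or> B2 \<subseteq> B1" using C(2) B by (auto simp: subset_chain_def)
      then obtain B where "B \<in> C" "x \<in> B" "y \<in> B" using B by blast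
      with Cin[of B] show ?thesis by (auto simp: \<A>_def subring_set_def)
    qed
    have "inverse \<pi> \<notin> \<Union>C" using Cin by (auto simp: \<A>_def)
    obtain B where "B \<in> C" using C(1) by blast
    then have "B \<in> C" "1 \<in> B" "A\<^sub>0 \<subseteq> B"
      using Cin[of B] unfolding \<A>_def subring_set_def by blast+
    have "1 \<in> \<Union>C" using \<open>B \<in> C\<close> \<open>1 \<in> B\<close> by (rule UnionI)
    have "A\<^sub>0 \<subseteq> \<Union>C" using \<open>A\<^sub>0 \<subseteq> B\<close> Union_upper[OF \<open>B \<in> C\<close>] by (rule order.trans)
    have "subring_set (\<Union>C)"
      unfolding subring_set_def using \<open>1 \<in> \<Union>C\<close> closed by meson
    then show "\<Union>C \<in> \<A>"
      unfolding \<A>_def mem_Collect_eq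
      using \<open>A\<^sub>0 \<subseteq> \<Union>C\<close> \<open>inverse \<pi> \<notin> \<Union>C\<close> by (intro conjI)
  qed
  then obtain A where "A \<in> \<A>" and A_max: "\<And>B. B \<in> \<A> \<Longrightarrow> A \<subseteq> B \<Longrightarrow> B = A"
    by blast
  then have M: "subring_set A" "A\<^sub>0 \<subseteq> A" "inverse \<pi> \<notin> A"
    by (simp_all add: \<A>_def)
  have max: "B = A" if "subring_set B" "A \<subseteq> B" "inverse \<pi> \<notin> B" for B
    using A_max[of B] that M(2) by (auto simp: \<A>_def)
  have ext: "\<exists>q\<in>poly_over A. \<pi> * poly q z = 1" if "z \<notin> A" for z
  proof -
    let ?B = "(\<lambda>q. poly q z) ` poly_over A"
    have "A \<subseteq> ?B"
    proof
      fix a assume "a \<in> A"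
      then show "a \<in> ?B"
        by (intro image_eqI[of _ _ "[:a:]"]) (auto intro!: poly_over_pCons poly_over_0 M)
    qed
    moreover have "z \<in> ?B"
      by (intro image_eqI[of _ _ "[:0, 1:]"])
        (auto intro!: poly_over_pCons poly_over_0 subring_0 subring_1 M)
    ultimately have "inverse \<pi> \<in> ?B"
      using max[OF subring_adjoin[OF M(1), of z]] that by blast
    then obtain q where "q \<in> poly_over A" "inverse \<pi> = poly q z" by blast
    then show ?thesis using assms(3) by (metis right_inverse)
  qed
  have "x \<in> A \<or> inverse x \<in> A" for x
  proof (rule ccontr)
    assume "\<not> ?thesis"
    then have x: "x \<notin> A" "inverse x \<notin> A" by auto
    then have "x \<noteq> 0" using subring_0[OF M(1)] by auto
    then have xy: "x * inverse x = 1" "inverse x * x = 1" by auto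
    define good where "good = (\<lambda>z q. q \<in> poly_over A \<and> \<pi> * poly q z = 1)"
    have "\<exists>q. good z q \<and> (\<forall>q'. good z q' \<longrightarrow> degree q \<le> degree q')" if z: "z \<notin> A" for z
    proof -
      obtain q where "good z q" using ext[OF z] by (auto simp: good_def)
      from ex_has_least_nat[of "good z", OF this, of degree] show ?thesis by auto
    qed
    from this[OF x(1)] this[OF x(2)] obtain q r
      where q: "good x q" "\<And>q'. good x q' \<Longrightarrow> degree q \<le> degree q'"
        and r: "good (inverse x) r" "\<And>q'. good (inverse x) q' \<Longrightarrow> degree r \<le> degree q'" by blast
    have pi: "\<pi> \<in> A" using assms M by auto
    note step = maximal_subring_step[OF M(1) pi assms(3) M(3) ext]
    show False
    proof (cases "degree r \<le> degree q")
      case True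
      show ?thesis
        by (rule step[OF _ xy(1), of q r]) (use True q r in \<open>auto simp: good_def\<close>)
    next
      case False
      show ?thesis
        by (rule step[OF _ xy(2), of r q]) (use False q r in \<open>auto simp: good_def\<close>)
    qed
  qed
  with M show ?thesis using that by blast
qed

section \<open>Sparse polynomials modulo the maximal ideal of a valuation ring\<close>

text \<open>A valuation ring of the whole ambient field.\<close>

definition valuation_ring :: "'a::field set \<Rightarrow> bool" where
  "valuation_ring A \<longleftrightarrow> subring_set A \<and> (\<forall>x. x \<in> A \<or> inverse x \<in> A)"

text \<open>The maximal ideal of a valuation ring. The case \<open>x = 0\<close> is listed separately because
  \<open>inverse 0 = 0\<close> belongs to the ring.\<close>

definition nonunits :: "'a::field set \<Rightarrow> 'a set" where
  "nonunits A = {x \<in> A. x = 0 \<or> inverse x \<notin> A}"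

context
  fixes A :: "'a::field set"
  assumes val: "valuation_ring A"
begin

lemma valuation_subring: "subring_set A"
  and valuation_cases: "x \<in> A \<or> inverse x \<in> A"
  using val by (auto simp: valuation_ring_def)

lemma nonunits_subset: "x \<in> nonunits A \<Longrightarrow> x \<in> A"
  by (auto simp: nonunits_def)

lemma nonunits_0: "0 \<in> nonunits A"
  by (auto simp: nonunits_def subring_0[OF valuation_subring])

lemma nonunits_1: "1 \<notin> nonunits A"
  by (auto simp: nonunits_def subring_1[OF valuation_subring])

lemma nonunits_mult:
  assumes a: "a \<in> A" and x: "x \<in> nonunits A"
  shows "a * x \<in> nonunits A"
proof (rule ccontr)
  assume *: "a * x \<notin> nonunits A"
  have "a * x \<in> A"
    using a nonunits_subset[OF x] by (rule subring_mult[OF valuation_subring])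
  with * have "a * x \<noteq> 0" "inverse (a * x) \<in> A"
    by (auto simp: nonunits_def)
  then have "a * inverse (a * x) \<in> A" "x \<noteq> 0"
    using subring_mult[OF valuation_subring a, of "inverse (a * x)"] by auto
  moreover have "a * inverse (a * x) = inverse x"
    using \<open>a * x \<noteq> 0\<close> by simp
  ultimately have "inverse x \<in> A \<and> x \<noteq> 0" by metis
  then show False using x by (simp add: nonunits_def)
qed

lemma nonunits_add:
  assumes x: "x \<in> nonunits A" and y: "y \<in> nonunits A"
  shows "x + y \<in> nonunits A"
proof (cases "x = 0 \<or> y = 0")
  case True
  then show ?thesis using assms by auto
next
  case False
  have *: "u + v \<in> nonunits A" if "u \<in> nonunits A" "v \<noteq> 0" "v \<in> nonunits A" "u * inverse v \<in> A" for u v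
  proof -
    have "(u * inverse v + 1) * v \<in> nonunits A"
      using that by (intro nonunits_mult subring_add subring_1 valuation_subring)
    then show ?thesis using that by (simp add: algebra_simps)
  qed
  have "x * inverse y \<in> A \<or> y * inverse x \<in> A"
    using valuation_cases[of "x * inverse y"] by (auto simp: mult.commute)
  then show ?thesis
    using *[OF x _ y] *[OF y _ x] False by (auto simp: add.commute)
qed

lemma nonunits_diff: "x \<in> nonunits A \<Longrightarrow> y \<in> nonunits A \<Longrightarrow> x - y \<in> nonunits A"
  using nonunits_add[of x "(- 1) * y"] nonunits_mult[of "- 1" y]
    subring_minus[OF valuation_subring subring_1[OF valuation_subring]] by simp

lemma nonunits_sum: "(\<And>i. i \<in> I \<Longrightarrow> f i \<in> nonunits A) \<Longrightarrow> sum f I \<in> nonunits A"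
  by (induction I rule: infinite_finite_induct) (auto intro: nonunits_add nonunits_0)

lemma nonunits_power:
  assumes "x \<in> A" "x ^ n \<in> nonunits A"
  shows "x \<in> nonunits A"
proof (rule ccontr)
  assume "x \<notin> nonunits A"
  then have x: "x \<noteq> 0" "inverse x \<in> A" using assms(1) by (auto simp: nonunits_def)
  then have "inverse x ^ n * x ^ n \<in> nonunits A"
    by (intro nonunits_mult assms subring_power valuation_subring)
  then show False using nonunits_1 x by (simp flip: power_mult_distrib)
qed

text \<open>If \<open>p\<close> lies in the maximal ideal, then the residue field has characteristic \<open>p\<close>, where \<open>1\<close> is
  the only \<open>p\<close>-th root of unity.\<close>
lemma root_of_unity_cong_1:
  assumes p: "prime p" and pn: "of_nat p \<in> nonunits A" and z: "z ^ p = 1"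
  shows "z \<in> A" "z - 1 \<in> nonunits A"
proof -
  have p0: "p > 0" using p prime_gt_0_nat by blast
  show zA: "z \<in> A"
  proof (rule ccontr)
    assume "z \<notin> A"
    then have "inverse z ^ (p - 1) \<in> A"
      using valuation_cases[of z] by (auto intro: subring_power[OF valuation_subring])
    moreover have "z * z ^ (p - 1) = 1"
      using z p0 by (metis power_minus_mult mult.commute)
    then have "inverse (z ^ (p - 1)) = z"
      by (metis inverse_unique mult.commute)
    ultimately show False using \<open>z \<notin> A\<close> by (simp add: power_inverse)
  qed
  define w where "w = z - 1"
  have wA: "w \<in> A"
    unfolding w_def by (intro subring_diff subring_1 zA valuation_subring)
  \<comment> \<open>all middle terms of the binomial expansion are divisible by \<open>p\<close>, hence so is \<open>w ^ p\<close>\<close>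
  have "1 = (w + 1) ^ p" using z by (simp add: w_def)
  also have "\<dots> = (\<Sum>k\<le>p. of_nat (p choose k) * w ^ k)"
    by (subst binomial_ring) simp
  also have "\<dots> = (\<Sum>k<p. of_nat (p choose k) * w ^ k) + w ^ p"
    by (simp flip: lessThan_Suc_atMost)
  also have "(\<Sum>k<p. of_nat (p choose k) * w ^ k) = 1 + (\<Sum>k=1..<p. of_nat (p choose k) * w ^ k)"
    unfolding lessThan_atLeast0 using p0 by (subst sum.atLeast_Suc_lessThan) auto
  finally have "w ^ p = 0 - (\<Sum>k=1..<p. of_nat (p choose k) * w ^ k)"
    by (simp add: algebra_simps eq_neg_iff_add_eq_0)
  also have "\<dots> \<in> nonunits A"
  proof (intro nonunits_diff nonunits_0 nonunits_sum)
    fix k assume k: "k \<in> {1..<p}"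
    then obtain c where "p choose k = p * c"
      using dvd_choose_prime[of k p] p by (auto simp: dvd_def)
    then have "of_nat (p choose k) * w ^ k = (of_nat c * w ^ k) * of_nat p"
      by simp
    also have "\<dots> \<in> nonunits A"
      by (intro nonunits_mult pn subring_mult subring_of_nat subring_power wA valuation_subring)
    finally show "of_nat (p choose k) * w ^ k \<in> nonunits A" .
  qed
  finally show "z - 1 \<in> nonunits A"
    using nonunits_power[OF wA] by (simp add: w_def)
qed

lemma nonunits_int_cancel:
  assumes p: "prime p" and pn: "of_nat p \<in> nonunits A"
    and c: "c \<in> A" and k: "\<not> int p dvd k" "of_int k * c \<in> nonunits A"
  shows "c \<in> nonunits A"
proof -
  have "coprime k (int p)"
    using p k(1) by (metis coprime_commute prime_imp_coprime prime_int_nat_transfer int_int_eq of_nat_id prime_nat_int_transfer)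
  then obtain i where "[k * i = 1] (mod int p)" using cong_solve_coprime_int by blast
  then obtain l where l: "k * i = 1 + int p * l"
    by (metis cong_iff_lin cong_sym)
  have "of_int (k * i) * c = of_int i * (of_int k * c)" by simp
  also have "\<dots> \<in> nonunits A"
    by (intro nonunits_mult k subring_of_int valuation_subring)
  finally have 1: "of_int (k * i) * c \<in> nonunits A" .
  have 2: "(of_int l * c) * of_nat p \<in> nonunits A"
    by (intro nonunits_mult pn subring_mult subring_of_int c valuation_subring)
  have "of_int (k * i) * c - (of_int l * c) * of_nat p = c"
    unfolding l by (simp add: algebra_simps)
  with nonunits_diff[OF 1 2] show ?thesis by simp
qed

lemma poly_nonunits_diff:
  "P \<in> poly_over (nonunits A) \<Longrightarrow> Q \<in> poly_over (nonunits A) \<Longrightarrow> P - Q \<in> poly_over (nonunits A)"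
  by (auto simp: poly_over_def intro: nonunits_diff)

lemma poly_nonunits_add:
  "P \<in> poly_over (nonunits A) \<Longrightarrow> Q \<in> poly_over (nonunits A) \<Longrightarrow> P + Q \<in> poly_over (nonunits A)"
  by (auto simp: poly_over_def intro: nonunits_add)

lemma poly_nonunits_mult:
  "P \<in> poly_over A \<Longrightarrow> Q \<in> poly_over (nonunits A) \<Longrightarrow> P * Q \<in> poly_over (nonunits A)"
  by (auto simp: poly_over_def coeff_mult intro!: nonunits_mult nonunits_sum)

lemma poly_nonunits_pderiv:
  "P \<in> poly_over (nonunits A) \<Longrightarrow> pderiv P \<in> poly_over (nonunits A)"
  by (auto simp: poly_over_def coeff_pderiv simp del: of_nat_Suc
      intro!: nonunits_mult subring_of_nat[OF valuation_subring])

lemma poly_nonunits_eval_1: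
  "P \<in> poly_over (nonunits A) \<Longrightarrow> poly P 1 \<in> nonunits A"
  by (auto simp: poly_over_def poly_altdef intro!: nonunits_sum)

lemma poly_nonunits_monom: "c \<in> nonunits A \<Longrightarrow> monom c n \<in> poly_over (nonunits A)"
  by (auto simp: poly_over_def nonunits_0)

lemma poly_nonunits_sum:
  "(\<And>i. i \<in> I \<Longrightarrow> f i \<in> poly_over (nonunits A)) \<Longrightarrow> sum f I \<in> poly_over (nonunits A)"
  by (auto simp: poly_over_def coeff_sum intro!: nonunits_sum)

text \<open>If all elements of \<open>J\<close> are congruent to \<open>1\<close>, then \<open>\<Prod>\<^sub>z (x - z)\<close> is congruent to a power of \<open>x - 1\<close>.\<close>

lemma prod_linear_cong:
  assumes "finite J" "J \<subseteq> A" "\<And>z. z \<in> J \<Longrightarrow> z - 1 \<in> nonunits A"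
  shows "(\<Prod>z\<in>J. [:- z, 1:]) - [:- 1, 1:] ^ card J \<in> poly_over (nonunits A)"
  using assms
proof (induction J rule: finite_induct)
  case empty
  then show ?case by (simp add: poly_over_def nonunits_0)
next
  case (insert z J)
  note S = valuation_subring
  let ?Q = "\<Prod>z\<in>J. [:- z, 1:]" and ?R = "[:- 1, 1:] ^ card J :: 'a poly"
  have "z \<in> A" using insert.prems by auto
  have 1: "[:- z, 1:] * (?Q - ?R) \<in> poly_over (nonunits A)"
  proof (rule poly_nonunits_mult)
    show "[:- z, 1:] \<in> poly_over A"
      using \<open>z \<in> A\<close> by (intro poly_over_pCons[OF S] poly_over_0[OF S] subring_minus[OF S] subring_1[OF S])
    show "?Q - ?R \<in> poly_over (nonunits A)"
      by (rule insert.IH) (use insert.prems in auto)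
  qed
  have "0 - (z - 1) \<in> nonunits A"
    by (rule nonunits_diff[OF nonunits_0]) (use insert.prems in auto)
  then have "[:1 - z:] \<in> poly_over (nonunits A)"
    by (auto simp: poly_over_def coeff_pCons nonunits_0 split: nat.splits)
  then have 2: "?R * [:1 - z:] \<in> poly_over (nonunits A)"
    by (intro poly_nonunits_mult poly_over_power[OF S] poly_over_pCons[OF S] poly_over_0[OF S]
        subring_minus[OF S] subring_1[OF S])
  have "[:- z, 1:] = [:- 1, 1:] + [:1 - z:]" by simp
  then have "(\<Prod>z\<in>insert z J. [:- z, 1:]) - [:- 1, 1:] ^ card (insert z J)
      = [:- z, 1:] * (?Q - ?R) + ?R * [:1 - z:]"
    unfolding prod.insert[OF insert.hyps] card_insert_disjoint[OF insert.hyps] power_Suc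
    by (simp only: algebra_simps)
  then show ?case using poly_nonunits_add[OF 1 2] by simp
qed

text \<open>
  A polynomial with exponents in \<open>K \<subseteq> {..<p}\<close> that is divisible by \<open>(x - 1)\<close> to the power
  \<open>card K\<close> modulo the maximal ideal vanishes modulo that ideal. For \<open>b \<in> K\<close> the operator
  \<open>Q \<mapsto> x Q' - b Q\<close> removes the term of exponent \<open>b\<close> and multiplies the other coefficients by
  the units \<open>a - b\<close>, while lowering the multiplicity of the zero at \<open>1\<close> by at most one.
\<close>
lemma sparse_poly_high_multiplicity:
  assumes p: "prime p" and pn: "of_nat p \<in> nonunits A"
  assumes "finite K" "K \<subseteq> {..<p}" "\<And>a. a \<in> K \<Longrightarrow> c a \<in> A" "h \<in> poly_over A"
    and "(\<Sum>a\<in>K. monom (c a) a) - [:- 1, 1:] ^ card K * h \<in> poly_over (nonunits A)"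
  shows "a \<in> K \<Longrightarrow> c a \<in> nonunits A"
  using assms(3-)
proof (induction K arbitrary: c h a rule: finite_induct)
  case empty
  then show ?case by simp
next
  case (insert b K)
  note S = valuation_subring
  define P where "P = (\<Sum>a\<in>insert b K. monom (c a) a)"
  define L where "L = [:- 1, 1 :: 'a:]"
  define k where "k = card K"
  have LA: "L \<in> poly_over A" unfolding L_def
    by (intro poly_over_pCons[OF S] poly_over_0[OF S] subring_minus[OF S] subring_1[OF S])
  have x: "[:0, 1:] \<in> poly_over A"
    by (intro poly_over_pCons[OF S] poly_over_0[OF S] subring_0[OF S] subring_1[OF S])
  define E where "E = P - L ^ Suc k * h"
  have E: "E \<in> poly_over (nonunits A)"
    using insert.prems(5) unfolding E_def P_def L_def k_def card_insert_disjoint[OF insert.hyps] .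
  define T where "T = (\<lambda>Q. [:0, 1:] * pderiv Q - [:of_nat b:] * Q :: 'a poly)"
  have TE: "T E \<in> poly_over (nonunits A)"
    unfolding T_def using E
    by (intro poly_nonunits_diff poly_nonunits_mult x poly_nonunits_pderiv poly_over_pCons[OF S]
        poly_over_0[OF S] subring_of_nat[OF S])
  define h' where "h' = [:0, 1:] * ([:of_nat (Suc k):] * h + L * pderiv h) - [:of_nat b:] * (L * h)"
  have h': "h' \<in> poly_over A"
    unfolding h'_def
    by (intro poly_over_diff[OF S] poly_over_add[OF S] poly_over_mult[OF S] x LA insert.prems
        poly_over_pderiv[OF S] poly_over_pCons[OF S] poly_over_0[OF S] subring_of_nat[OF S])
  have dL: "pderiv L = 1" by (simp add: L_def pderiv_pCons)
  have "T (L ^ Suc k * h) = L ^ k * h'"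
  proof -
    have "pderiv (L ^ Suc k * h) = L ^ k * ([:of_nat (Suc k):] * h + L * pderiv h)"
      unfolding pderiv_mult pderiv_power_Suc dL
      by (simp add: algebra_simps del: of_nat_Suc)
    then show ?thesis
      unfolding T_def h'_def by (simp only: power_Suc) (simp only: algebra_simps)
  qed
  moreover have TP: "T P = (\<Sum>a\<in>K. monom (of_int (int a - int b) * c a) a)"
  proof -
    have *: "T (monom d a) = monom (of_int (int a - int b) * d) a" for a d
      by (rule poly_eqI, cases a)
        (auto simp: T_def pderiv_monom coeff_pCons left_diff_distrib
          simp del: of_nat_Suc split: nat.splits)
    have "T (Q + R) = T Q + T R" for Q R
      unfolding T_def pderiv_add by (simp only: algebra_simps)
    then have "T (\<Sum>a\<in>I. f a) = (\<Sum>a\<in>I. T (f a))" for I and f :: "nat \<Rightarrow> 'a poly"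
      by (induction I rule: infinite_finite_induct)
        (simp_all, simp_all add: T_def)
    then have "T P = (\<Sum>a\<in>insert b K. monom (of_int (int a - int b) * c a) a)"
      unfolding P_def by (simp only: *)
    then show ?thesis using insert.hyps by simp
  qed
  moreover have "T E = T P - T (L ^ Suc k * h)"
    unfolding E_def T_def pderiv_diff by (simp only: algebra_simps)
  ultimately have *: "(\<Sum>a\<in>K. monom (of_int (int a - int b) * c a) a) - L ^ k * h'
      \<in> poly_over (nonunits A)"
    using TE by (simp only:)
  have K: "c a \<in> nonunits A" if "a \<in> K" for a
  proof (rule nonunits_int_cancel[OF p pn, where k = "int a - int b"])
    show "c a \<in> A" using insert.prems that by auto
    have "a < p" "b < p" "a \<noteq> b" using insert.prems insert.hyps that by auto
    then show "\<not> int p dvd int a - int b"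
      using dvd_imp_le_int[of "int a - int b" "int p"] by auto
    show "of_int (int a - int b) * c a \<in> nonunits A"
      by (rule insert.IH[OF that _ _ h' *[unfolded L_def k_def]])
        (use insert.prems in \<open>auto intro!: subring_mult[OF S] subring_diff[OF S] subring_of_nat[OF S]\<close>)
  qed
  have "P = monom (c b) b + (\<Sum>a\<in>K. monom (c a) a)"
    unfolding P_def using insert.hyps by simp
  moreover have "poly (E - (\<Sum>a\<in>K. monom (c a) a)) 1 \<in> nonunits A"
    by (intro poly_nonunits_eval_1 poly_nonunits_diff E poly_nonunits_sum poly_nonunits_monom K)
  ultimately have "c b \<in> nonunits A"
    by (simp add: E_def L_def poly_monom)
  then show ?case using K insert.prems by auto
qed

text \<open>Among finitely many field elements, not all zero, some element divides all the others
  in the valuation ring.\<close>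

lemma ex_common_scale:
  assumes "finite I" "i \<in> I" "c i \<noteq> 0"
  shows "\<exists>j\<in>I. c j \<noteq> 0 \<and> (\<forall>i\<in>I. c i * inverse (c j) \<in> A)"
  using assms
proof (induction I arbitrary: i rule: finite_induct)
  case empty
  then show ?case by simp
next
  case (insert b I)
  note S = valuation_subring
  show ?case
  proof (cases "\<exists>i\<in>I. c i \<noteq> 0")
    case False
    then show ?thesis using insert.prems
      by (intro bexI[of _ b]) (auto intro: subring_0[OF S] subring_1[OF S])
  next
    case True
    then obtain j where j: "j \<in> I" "c j \<noteq> 0" "\<And>i. i \<in> I \<Longrightarrow> c i * inverse (c j) \<in> A"
      using insert.IH by blast
    show ?thesis
    proof (cases "c b * inverse (c j) \<in> A")
      case True
      then show ?thesis using j by (intro bexI[of _ j]) auto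
    next
      case False
      then have b0: "c b \<noteq> 0" using subring_0[OF S] by auto
      have 1: "c j * inverse (c b) \<in> A"
        using valuation_cases[of "c b * inverse (c j)"] False by (simp add: mult.commute)
      have "c i * inverse (c b) \<in> A" if "i \<in> I" for i
      proof -
        have "c i * inverse (c b) = (c i * inverse (c j)) * (c j * inverse (c b))"
          using j(2) by simp
        also have "\<dots> \<in> A" using j(3)[OF that] 1 by (rule subring_mult[OF S])
        finally show ?thesis .
      qed
      then show ?thesis using b0 by (intro bexI[of _ b]) (auto intro: subring_1[OF S])
    qed
  qed
qed

end

section \<open>The uncertainty principle for prime cyclic groups\<close>

theorem sparse_poly_roots_of_unity:
  fixes P :: "complex poly"
  assumes p: "prime p" and P: "P \<noteq> 0" "degree P < p"
  shows "card {z. z ^ p = 1 \<and> poly P z = 0} < card {i. coeff P i \<noteq> 0}"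
proof (rule ccontr)
  define K where "K = {i. coeff P i \<noteq> 0}"
  assume "\<not> ?thesis"
  then have "card K \<le> card {z. z ^ p = 1 \<and> poly P z = 0}" by (simp add: K_def)
  then obtain J where J: "J \<subseteq> {z. z ^ p = 1 \<and> poly P z = 0}" "card J = card K" "finite J"
    by (meson obtain_subset_with_card_n)
  have Ksub: "K \<subseteq> {..<p}" unfolding K_def using P(2) le_degree[of P] by force
  then have Kfin: "finite K" using finite_subset by blast
  have p1: "p > 1" using p prime_gt_1_nat by blast
  let ?Z = "range (of_int :: int \<Rightarrow> complex)"
  have "subring_set ?Z"
    unfolding subring_set_def
  proof safe
    show "1 \<in> ?Z" by (metis of_int_1 rangeI)
    show "of_int a - of_int b \<in> ?Z" "of_int a * of_int b \<in> ?Z" for a b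
      by (metis of_int_diff rangeI, metis of_int_mult rangeI)
  qed
  moreover have "of_nat p \<in> ?Z" by (metis of_int_of_nat_eq rangeI)
  moreover have "inverse (of_nat p) \<notin> ?Z"
  proof
    assume "inverse (of_nat p) \<in> ?Z"
    then obtain k where "inverse (of_nat p) = (of_int k :: complex)" by auto
    then have "of_int (k * int p) = (of_int 1 :: complex)"
      using p1 by (simp flip: \<open>inverse (of_nat p) = of_int k\<close>)
    then have "k * int p = 1" by (simp only: of_int_eq_iff)
    then show False using p1 by (auto simp: zmult_eq_1_iff)
  qed
  ultimately obtain A :: "complex set" where A: "subring_set A" "inverse (of_nat p) \<notin> A"
    "\<And>x. x \<in> A \<or> inverse x \<in> A"
    using p1 by (metis ex_valuation_ring of_nat_eq_0_iff not_one_less_zero)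
  have V: "valuation_ring A" using A by (auto simp: valuation_ring_def)
  have pn: "of_nat p \<in> nonunits A"
    using A p1 by (auto simp: nonunits_def subring_of_nat)
  have "lead_coeff P \<noteq> 0" using P by simp
  then obtain j where j: "coeff P j \<noteq> 0" "\<And>i. i \<in> K \<Longrightarrow> coeff P i * inverse (coeff P j) \<in> A"
    using ex_common_scale[OF V Kfin, of "degree P" "coeff P"] by (auto simp: K_def)
  define c where "c = (\<lambda>i. coeff P i * inverse (coeff P j))"
  define Q where "Q = (\<Sum>a\<in>K. monom (c a) a)"
  have Q: "Q = smult (inverse (coeff P j)) P"
    by (rule poly_eqI) (use Kfin in \<open>auto simp: Q_def coeff_sum c_def K_def if_distrib cong: if_cong\<close>)
  have QA: "Q \<in> poly_over A"
    unfolding Q_def c_def by (intro poly_over_sum[OF A(1)] poly_over_monom[OF A(1)] j)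
  have J1: "z - 1 \<in> nonunits A" if "z \<in> J" for z
    using root_of_unity_cong_1[OF V p pn] J that by auto
  have JA: "J \<subseteq> A"
    using root_of_unity_cong_1[OF V p pn] J by auto
  obtain h where h: "h \<in> poly_over A" "Q = (\<Prod>z\<in>J. [:- z, 1:]) * h"
    using poly_over_factor_roots[OF A(1) J(3) JA QA] J(1) by (auto simp: Q)
  have "h * ((\<Prod>z\<in>J. [:- z, 1:]) - [:- 1, 1:] ^ card J) \<in> poly_over (nonunits A)"
    by (intro poly_nonunits_mult[OF V] h prod_linear_cong[OF V] J JA J1)
  then have "Q - [:- 1, 1:] ^ card K * h \<in> poly_over (nonunits A)"
    by (simp only: h(2) J(2)) (simp only: algebra_simps)
  moreover have "j \<in> K" using j by (simp add: K_def)
  ultimately have "c j \<in> nonunits A"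
    using sparse_poly_high_multiplicity[OF V p pn Kfin Ksub _ h(1), of c j] j
    unfolding Q_def c_def by blast
  then show False using j nonunits_1[OF V] by (simp add: c_def)
qed

text \<open>\<open>exp (2 \<pi> i k / p)\<close>.\<close>

definition unity_root :: "nat \<Rightarrow> int \<Rightarrow> complex" where
  "unity_root p k = cis (2 * pi * of_int k / of_nat p)"

lemma unity_root_0: "unity_root p 0 = 1"
  by (simp add: unity_root_def)

lemma unity_root_add: "unity_root p (a + b) = unity_root p a * unity_root p b"
  by (simp add: unity_root_def cis_mult add_divide_distrib distrib_left)

lemma unity_root_nz: "unity_root p k \<noteq> 0"
  by (simp add: unity_root_def)

lemma cnj_unity_root: "cnj (unity_root p k) = unity_root p (- k)"
  by (simp add: unity_root_def cis_cnj)

lemma unity_root_power: "unity_root p k ^ n = unity_root p (int n * k)"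
  by (induction n) (simp_all add: unity_root_0 distrib_right flip: unity_root_add)

lemma unity_root_eq_1_iff:
  assumes "p > 0"
  shows "unity_root p k = 1 \<longleftrightarrow> int p dvd k"
proof
  assume "unity_root p k = 1"
  then have "cos (2 * pi * of_int k / of_nat p) = 1"
    by (simp add: unity_root_def complex_eq_iff)
  then obtain n :: int where "2 * pi * of_int k / of_nat p = of_int n * 2 * pi"
    using cos_one_2pi_int by auto
  then have "real_of_int k = of_int n * of_nat p"
    using assms by (simp add: field_simps)
  also have "\<dots> = of_int (n * int p)" by simp
  finally have "k = n * int p" by (simp only: of_int_eq_iff)
  then show "int p dvd k" by simp
next
  assume "int p dvd k"
  then obtain n where "k = int p * n" ..
  then have "2 * pi * of_int k / of_nat p = 2 * pi * of_int n"
    using assms by simp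
  then show "unity_root p k = 1"
    by (simp add: unity_root_def cis_multiple_2pi)
qed

lemma unity_root_eq_iff:
  assumes "p > 0"
  shows "unity_root p a = unity_root p b \<longleftrightarrow> [a = b] (mod int p)"
proof -
  have "unity_root p a = unity_root p b \<longleftrightarrow> unity_root p (a - b) = 1"
    using unity_root_add[of p "a - b" b] unity_root_nz[of p b] by auto
  then show ?thesis
    using unity_root_eq_1_iff[OF assms] by (simp add: cong_iff_dvd_diff)
qed

lemma unity_root_cong: "p > 0 \<Longrightarrow> [a = b] (mod int p) \<Longrightarrow> unity_root p a = unity_root p b"
  by (simp add: unity_root_eq_iff)

lemma roots_of_unity_surj:
  assumes "p > 0" "z ^ p = 1"
  shows "\<exists>k\<in>{0..<int p}. z = unity_root p k"
proof -
  have inj: "inj_on (unity_root p) {0..<int p}"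
    using assms by (auto simp: inj_on_def unity_root_eq_iff cong_less_imp_eq_int)
  have sub: "unity_root p ` {0..<int p} \<subseteq> {z. z ^ p = 1}"
    using assms by (auto simp: unity_root_power unity_root_eq_1_iff)
  have "card (unity_root p ` {0..<int p}) = p"
    using card_image[OF inj] by simp
  then have "unity_root p ` {0..<int p} = {z. z ^ p = 1}"
    using assms sub card_roots_unity_eq[of p] finite_roots_unity[of p]
    by (intro card_subset_eq) auto
  then show ?thesis using assms by auto
qed

text \<open>The unnormalised Fourier transform modulo \<open>p\<close>. Residue classes are represented by
  \<open>{0..<int p}\<close>, and values of \<open>g\<close> outside this set play no role.\<close>

definition dft :: "nat \<Rightarrow> (int \<Rightarrow> complex) \<Rightarrow> int \<Rightarrow> complex" where
  "dft p g t = (\<Sum>x\<in>{0..<int p}. g x * unity_root p (- (t * x)))"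

text \<open>The theorem of Biro, Meshulam and Tao. The transform of \<open>g\<close>
  lists the values at the \<open>p\<close>-th roots of unity of the polynomial with coefficients \<open>g\<close>.\<close>

theorem uncertainty_prime:
  assumes p: "prime p" and x: "x \<in> {0..<int p}" "g x \<noteq> 0"
  shows "card {x\<in>{0..<int p}. g x \<noteq> 0} + card {t\<in>{0..<int p}. dft p g t \<noteq> 0} \<ge> p + 1"
proof -
  define I where "I = {0..<int p}"
  have p0: "p > 0" using p prime_gt_0_nat by blast
  define P where "P = (\<Sum>i<p. monom (g (int i)) i)"
  have cP: "coeff P i = (if i < p then g (int i) else 0)" for i
    by (auto simp: P_def coeff_sum)
  have ev: "poly P (unity_root p (- t)) = dft p g t" for t
  proof -
    have "poly P (unity_root p (- t)) = (\<Sum>i<p. g (int i) * unity_root p (- (t * int i)))"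
      by (simp add: P_def poly_sum poly_monom unity_root_power mult.commute)
    also have "\<dots> = dft p g t"
      unfolding dft_def
      by (rule sum.reindex_bij_witness[of _ nat int]) auto
    finally show ?thesis .
  qed
  have "coeff P (nat x) \<noteq> 0" using x by (auto simp: cP)
  then have P0: "P \<noteq> 0" by auto
  have dP: "degree P < p"
    using p0 by (intro le_less_trans[OF degree_le[of "p - 1"]]) (auto simp: cP)
  have "card {t\<in>I. dft p g t = 0} = card ((\<lambda>t. unity_root p (- t)) ` {t\<in>I. dft p g t = 0})"
    using p0 cong_minus_minus_iff
    by (intro card_image[symmetric])
      (auto simp: I_def inj_on_def unity_root_eq_iff cong_minus_minus_iff cong_less_imp_eq_int)
  also have "\<dots> \<le> card {z. z ^ p = 1 \<and> poly P z = 0}"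
  proof (rule card_mono)
    show "finite {z. z ^ p = 1 \<and> poly P z = 0}"
      using poly_roots_finite[OF P0] by (rule rev_finite_subset) auto
    show "(\<lambda>t. unity_root p (- t)) ` {t \<in> I. dft p g t = 0} \<subseteq> {z. z ^ p = 1 \<and> poly P z = 0}"
      using p0 by (auto simp: ev unity_root_power unity_root_eq_1_iff)
  qed
  also have "\<dots> < card {i. coeff P i \<noteq> 0}"
    by (rule sparse_poly_roots_of_unity[OF p P0 dP])
  also have "\<dots> = card (nat ` {x\<in>I. g x \<noteq> 0})"
  proof (rule arg_cong[where f = card], intro equalityI subsetI)
    fix i assume "i \<in> {i. coeff P i \<noteq> 0}"
    then show "i \<in> nat ` {x\<in>I. g x \<noteq> 0}"
      by (intro image_eqI[of _ _ "int i"]) (auto simp: cP split: if_splits simp: I_def)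
  next
    fix i assume "i \<in> nat ` {x\<in>I. g x \<noteq> 0}"
    then show "i \<in> {i. coeff P i \<noteq> 0}"
      unfolding cP I_def by (auto simp: nat_less_iff)
  qed
  also have "\<dots> = card {x\<in>I. g x \<noteq> 0}"
    by (rule card_image) (auto simp: inj_on_def I_def)
  finally have "card {t\<in>I. dft p g t = 0} < card {x\<in>I. g x \<noteq> 0}" .
  moreover have "card {t\<in>I. dft p g t = 0} + card {t\<in>I. dft p g t \<noteq> 0} = p"
  proof -
    have "finite I" by (simp add: I_def)
    then have "card {t\<in>I. dft p g t = 0} + card {t\<in>I. dft p g t \<noteq> 0}
        = card ({t\<in>I. dft p g t = 0} \<union> {t\<in>I. dft p g t \<noteq> 0})"
      by (intro card_Un_disjoint[symmetric]) auto
    also have "{t\<in>I. dft p g t = 0} \<union> {t\<in>I. dft p g t \<noteq> 0} = I" by blast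
    finally have "card {t\<in>I. dft p g t = 0} + card {t\<in>I. dft p g t \<noteq> 0} = card I" .
    then show ?thesis by (simp add: I_def)
  qed
  ultimately show ?thesis unfolding I_def by linarith
qed

section \<open>Counting parallel lines that meet the supports\<close>

text \<open>The unnormalised Fourier transform on the plane of order \<open>p\<close>.\<close>

definition dft2 :: "nat \<Rightarrow> (int \<Rightarrow> int \<Rightarrow> complex) \<Rightarrow> int \<Rightarrow> int \<Rightarrow> complex" where
  "dft2 p F s t = (\<Sum>x\<in>{0..<int p}. \<Sum>y\<in>{0..<int p}. F x y * unity_root p (- (s * x + t * y)))"

lemma dft_nonzero:
  assumes p: "prime p" and x: "x \<in> {0..<int p}" "g x \<noteq> 0"
  shows "\<exists>t\<in>{0..<int p}. dft p g t \<noteq> 0"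
proof (rule ccontr)
  assume "\<not> ?thesis"
  then have "{t\<in>{0..<int p}. dft p g t \<noteq> 0} = {}" by blast
  then have "card {t\<in>{0..<int p}. dft p g t \<noteq> 0} = 0" by (simp only: card.empty)
  moreover have "card {x\<in>{0..<int p}. g x \<noteq> 0} \<le> card {0..<int p}"
    by (intro card_mono) auto
  moreover have "card {x\<in>{0..<int p}. g x \<noteq> 0} + card {t\<in>{0..<int p}. dft p g t \<noteq> 0} \<ge> p + 1"
    using p x by (rule uncertainty_prime)
  ultimately show False by simp
qed

lemma dft2_eq_dft_dft: "dft2 p F s t = dft p (\<lambda>x. dft p (F x) t) s"
proof -
  have "unity_root p (- (s * x + t * y)) = unity_root p (- (t * y)) * unity_root p (- (s * x))" for x y
    by (simp add: add_ac flip: unity_root_add)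
  then show ?thesis
    by (simp add: dft2_def dft_def sum_distrib_right mult.assoc)
qed

lemma dft2_nonzero:
  assumes p: "prime p" and "x \<in> {0..<int p}" "y \<in> {0..<int p}" "F x y \<noteq> 0"
  shows "\<exists>s\<in>{0..<int p}. \<exists>t\<in>{0..<int p}. dft2 p F s t \<noteq> 0"
proof -
  obtain t where t: "t \<in> {0..<int p}" "dft p (F x) t \<noteq> 0"
    using dft_nonzero[where g = "F x", OF p assms(3,4)] by blast
  obtain s where "s \<in> {0..<int p}" "dft2 p F s t \<noteq> 0"
    using dft_nonzero[where g = "\<lambda>x. dft p (F x) t", OF p assms(2) t(2)]
    unfolding dft2_eq_dft_dft by blast
  with t(1) show ?thesis by blast
qed

text \<open>
  The counting bounds for the two coordinate directions. The intermediate function \<open>G\<close> is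
  transformed in the second variable only: each row \<open>F x\<close> is transformed to the row \<open>G x\<close>,
  which has support of size at most \<open>k\<close>, and each column of \<open>G\<close>, which has support of size at
  most \<open>n\<close>, is transformed to a column of \<open>dft2 p F\<close>.
\<close>

lemma line_count_bounds:
  fixes F :: "int \<Rightarrow> int \<Rightarrow> complex"
  assumes p: "prime p"
  defines "I \<equiv> {0..<int p}"
  defines "n \<equiv> card {x\<in>I. \<exists>y\<in>I. F x y \<noteq> 0}"
    and "k \<equiv> card {t\<in>I. \<exists>s\<in>I. dft2 p F s t \<noteq> 0}"
  shows "card {(x, y)\<in>I \<times> I. F x y \<noteq> 0} \<ge> n * (p + 1 - k)"
    and "card {(s, t)\<in>I \<times> I. dft2 p F s t \<noteq> 0} \<ge> k * (p + 1 - n)"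
proof -
  have fin: "finite I" by (simp add: I_def)
  define G where "G = (\<lambda>x t. dft p (F x) t)"
  have G: "dft2 p F s t = dft p (\<lambda>x. G x t) s" for s t
    by (simp add: G_def dft2_eq_dft_dft)
  have count: "card {(a, b)\<in>I \<times> I. Q a b} = (\<Sum>a\<in>I. card {b\<in>I. Q a b})"
    for Q :: "int \<Rightarrow> int \<Rightarrow> bool"
  proof -
    have "{(a, b)\<in>I \<times> I. Q a b} = (SIGMA a:I. {b\<in>I. Q a b})" by auto
    then show ?thesis using fin by simp
  qed
  have col_nz: "\<exists>s\<in>I. dft2 p F s t \<noteq> 0" if "x \<in> I" "G x t \<noteq> 0" for x t
    unfolding I_def G using that dft_nonzero[where g = "\<lambda>x. G x t", OF p] by (simp add: I_def)
  show "card {(x, y)\<in>I \<times> I. F x y \<noteq> 0} \<ge> n * (p + 1 - k)"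
  proof -
    let ?N = "{x\<in>I. \<exists>y\<in>I. F x y \<noteq> 0}"
    have "p + 1 - k \<le> card {y\<in>I. F x y \<noteq> 0}" if "x \<in> ?N" for x
    proof -
      obtain y where y: "y \<in> I" "F x y \<noteq> 0" "x \<in> I" using \<open>x \<in> ?N\<close> by auto
      have "p + 1 \<le> card {y\<in>I. F x y \<noteq> 0} + card {t\<in>I. G x t \<noteq> 0}"
        unfolding I_def G_def using y by (intro uncertainty_prime[OF p, of y]) (auto simp: I_def)
      moreover have "card {t\<in>I. G x t \<noteq> 0} \<le> k"
        unfolding k_def using fin y(3) col_nz by (intro card_mono) auto
      ultimately show ?thesis by linarith
    qed
    then have "n * (p + 1 - k) \<le> (\<Sum>x\<in>?N. card {y\<in>I. F x y \<noteq> 0})"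
      unfolding n_def using sum_bounded_below[of ?N "p + 1 - k"] by simp
    also have "\<dots> \<le> (\<Sum>x\<in>I. card {y\<in>I. F x y \<noteq> 0})"
      using fin by (intro sum_mono2) auto
    finally show ?thesis by (simp only: count)
  qed
  show "card {(s, t)\<in>I \<times> I. dft2 p F s t \<noteq> 0} \<ge> k * (p + 1 - n)"
  proof -
    let ?K = "{t\<in>I. \<exists>s\<in>I. dft2 p F s t \<noteq> 0}"
    have "p + 1 - n \<le> card {s\<in>I. dft2 p F s t \<noteq> 0}" if "t \<in> ?K" for t
    proof -
      obtain s where "s \<in> I" "dft2 p F s t \<noteq> 0" using \<open>t \<in> ?K\<close> by auto
      then obtain x where x: "x \<in> I" "G x t \<noteq> 0"
        unfolding G dft_def I_def using sum.neutral by (metis (no_types, lifting) mult_zero_left)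
      then have "p + 1 \<le> card {x\<in>I. G x t \<noteq> 0} + card {s\<in>I. dft2 p F s t \<noteq> 0}"
        unfolding I_def G by (intro uncertainty_prime[OF p, of x]) (auto simp: I_def)
      moreover have "card {x\<in>I. G x t \<noteq> 0} \<le> n"
        unfolding n_def
      proof (intro card_mono)
        show "{x\<in>I. G x t \<noteq> 0} \<subseteq> {x\<in>I. \<exists>y\<in>I. F x y \<noteq> 0}"
          unfolding G_def dft_def I_def by (auto intro: sum.neutral)
      qed (use fin in auto)
      ultimately show ?thesis by linarith
    qed
    then have "k * (p + 1 - n) \<le> (\<Sum>t\<in>?K. card {s\<in>I. dft2 p F s t \<noteq> 0})"
      unfolding k_def using sum_bounded_below[of ?K "p + 1 - n"] by simp
    also have "\<dots> \<le> (\<Sum>t\<in>I. card {s\<in>I. dft2 p F s t \<noteq> 0})"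
      using fin by (intro sum_mono2) auto
    also have "\<dots> = card {(t, s)\<in>I \<times> I. dft2 p F s t \<noteq> 0}" by (simp only: count)
    also have "\<dots> = card (prod.swap ` {(t, s)\<in>I \<times> I. dft2 p F s t \<noteq> 0})"
      by (intro card_image[symmetric]) (auto simp: inj_on_def)
    also have "prod.swap ` {(t, s)\<in>I \<times> I. dft2 p F s t \<noteq> 0} = {(s, t)\<in>I \<times> I. dft2 p F s t \<noteq> 0}"
      by auto
    finally show ?thesis .
  qed
qed

section \<open>The arithmetic of the counting bounds\<close>
lemma uncertainty_arith_box:
  fixes n k p :: real
  assumes "2 \<le> n" "n \<le> p - 1" "2 \<le> k" "k \<le> p - 1"
  shows "n * (p + 1 - k) + k * (p + 1 - n) \<ge> 4 * (p - 1)"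
proof -
  have "n * (p + 1 - k) + k * (p + 1 - n) - 4 * (p - 1)
     = (n - 2) * (p - 1 - k) + (k - 2) * (p - 1 - n)"
    by (simp add: algebra_simps)
  also have "\<dots> \<ge> 0"
    using assms by (intro add_nonneg_nonneg mult_nonneg_nonneg) auto
  finally show ?thesis by simp
qed

text \<open>
  The two hypotheses \<open>small\<close> together are the negation of the main inequality. They are
  incompatible with the bounds \<open>st\<close> on the square \<open>2 \<le> n, k \<le> p - 1\<close>, by adding them, and on
  its outer rim except at the corners \<open>(1, 1)\<close> and \<open>(p, p)\<close>, by using one of them.
\<close>

lemma direction_dichotomy:
  fixes p n k \<sigma> \<tau> :: nat
  assumes p: "p \<ge> 3" and n: "1 \<le> n" "n \<le> p" and k: "1 \<le> k" "k \<le> p"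
    and st: "n * (p + 1 - k) \<le> \<sigma>" "k * (p + 1 - n) \<le> \<tau>"
    and small: "real \<sigma> / (real p - 1) + real \<tau> / 2 < real p + 1"
      "real \<tau> / (real p - 1) + real \<sigma> / 2 < real p + 1"
  shows "n = 1 \<and> k = 1 \<or> n = p \<and> k = p" and "\<sigma> + \<tau> < 4 * (p - 1)"
proof -
  define P N K s t where "P = real p" and "N = real n" and "K = real k"
    and "s = real \<sigma>" and "t = real \<tau>"
  note defs = P_def N_def K_def s_def t_def
  have P: "P \<ge> 3" using p by (simp add: defs)
  have s: "N * (P + 1 - K) \<le> s"
  proof -
    have "real (n * (p + 1 - k)) \<le> real \<sigma>" using st by (simp only: of_nat_le_iff)
    moreover have "real (p + 1 - k) = P + 1 - K" using k by (simp add: defs of_nat_diff)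
    ultimately show ?thesis by (simp add: N_def s_def)
  qed
  have t: "K * (P + 1 - N) \<le> t"
  proof -
    have "real (k * (p + 1 - n)) \<le> real \<tau>" using st by (simp only: of_nat_le_iff)
    moreover have "real (p + 1 - n) = P + 1 - N" using n by (simp add: defs of_nat_diff)
    ultimately show ?thesis by (simp add: K_def t_def)
  qed
  have A: "2 * s + (P - 1) * t < 2 * (P + 1) * (P - 1)"
    using small(1) P unfolding defs[symmetric] by (simp add: field_simps)
  have B: "2 * t + (P - 1) * s < 2 * (P + 1) * (P - 1)"
    using small(2) P unfolding defs[symmetric] by (simp add: field_simps)
  have "(P + 1) * (s + t) < (P + 1) * (4 * (P - 1))"
    using A B by (simp add: algebra_simps)
  then have sum: "s + t < 4 * (P - 1)" using P by simp
  then show "\<sigma> + \<tau> < 4 * (p - 1)" using p by (simp add: defs of_nat_diff)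
  have large: "2 * (P + 1) * (P - 1) \<le> 2 * a + (P - 1) * b"
    if "0 \<le> c" "a \<ge> P - 1 - c" "b \<ge> P * (2 + c)" for a b c
  proof -
    have "(P - 1) * (P * (2 + c)) \<le> (P - 1) * b"
      using that P by (intro mult_left_mono) auto
    moreover have "3 * 2 \<le> P * (P - 1)" using P by (intro mult_mono) auto
    then have "0 \<le> c * (P * (P - 1) - 2)" using that(1) by (intro mult_nonneg_nonneg) auto
    ultimately show ?thesis using that(2) by (simp add: algebra_simps)
  qed
  show "n = 1 \<and> k = 1 \<or> n = p \<and> k = p"
  proof (rule ccontr)
    assume *: "\<not> ?thesis"
    consider (a) "n = 1" "k \<ge> 2" | (b) "k = 1" "n \<ge> 2" | (c) "n = p" "k < p"
      | (d) "k = p" "n < p" | (e) "2 \<le> n" "n < p" "2 \<le> k" "k < p"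
    proof -
      have "n = 1 \<and> k \<ge> 2 \<or> k = 1 \<and> n \<ge> 2 \<or> n = p \<and> k < p \<or> k = p \<and> n < p
          \<or> 2 \<le> n \<and> n < p \<and> 2 \<le> k \<and> k < p"
        using * n k by (cases "n = 1"; cases "k = 1"; cases "n = p"; cases "k = p") auto
      then show ?thesis using that by blast
    qed
    then show False
    proof cases
      case a
      then have "0 \<le> K - 2" "N = 1" by (simp_all add: defs)
      then show False using large[of "K - 2" s t] A s t by (simp add: algebra_simps)
    next
      case b
      then have "0 \<le> N - 2" "K = 1" by (simp_all add: defs)
      then show False using large[of "N - 2" t s] B s t by (simp add: algebra_simps)
    next
      case c
      then have "0 \<le> P - 1 - K" "N = P" using p by (simp_all add: defs of_nat_diff)
      then show False using large[of "P - 1 - K" t s] B s t by (simp add: algebra_simps)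
    next
      case d
      then have "0 \<le> P - 1 - N" "K = P" using p by (simp_all add: defs of_nat_diff)
      then show False using large[of "P - 1 - N" s t] A s t by (simp add: algebra_simps)
    next
      case e
      then have "2 \<le> N" "N \<le> P - 1" "2 \<le> K" "K \<le> P - 1" using p by (simp_all add: defs of_nat_diff)
      from uncertainty_arith_box[OF this] sum s t show False by linarith
    qed
  qed
qed

section \<open>Blocking sets in the affine plane\<close>
lemma sum_powers_dvd:
  assumes p: "prime p" and i: "i < p - 1"
  shows "int p dvd (\<Sum>u\<in>{0..<int p}. u ^ i)"
proof -
  define S where "S = (\<lambda>i. \<Sum>u<p. int u ^ i)"
  have "int p dvd S i"
    using i
  proof (induction i rule: less_induct)
    case (less i)
    \<comment> \<open>telescoping expresses the \<open>i\<close>-th power sum by the lower ones\<close>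
    have "int p ^ Suc i = (\<Sum>u<p. int (Suc u) ^ Suc i - int u ^ Suc i)"
      by (subst sum_lessThan_telescope) simp
    also have "\<dots> = (\<Sum>u<p. \<Sum>j\<le>i. int (Suc i choose j) * int u ^ j)"
    proof (rule sum.cong, simp)
      fix u
      have "int (Suc u) ^ Suc i = (\<Sum>j\<le>Suc i. int (Suc i choose j) * int u ^ j)"
        using binomial_ring[of "int u" 1 "Suc i"] by (simp add: add.commute)
      then show "int (Suc u) ^ Suc i - int u ^ Suc i = (\<Sum>j\<le>i. int (Suc i choose j) * int u ^ j)"
        by (simp add: sum.atMost_Suc)
    qed
    also have "\<dots> = (\<Sum>j\<le>i. int (Suc i choose j) * S j)"
      unfolding S_def sum_distrib_left by (rule sum.swap)
    also have "\<dots> = (\<Sum>j<i. int (Suc i choose j) * S j) + int (Suc i) * S i"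
      by (simp flip: lessThan_Suc_atMost)
    finally have eq: "int (Suc i) * S i = int p ^ Suc i - (\<Sum>j<i. int (Suc i choose j) * S j)"
      by simp
    have "int p dvd (\<Sum>j<i. int (Suc i choose j) * S j)"
      using less by (intro dvd_sum dvd_mult) auto
    then have "int p dvd int (Suc i) * S i"
      unfolding eq by (intro dvd_diff) auto
    moreover have "\<not> int p dvd int (Suc i)"
      using less.prems by (simp only: int_dvd_int_iff) (auto dest: dvd_imp_le)
    ultimately show ?case
      using p prime_dvd_mult_iff[of "int p"] by auto
  qed
  moreover have "(\<Sum>u\<in>{0..<int p}. u ^ i) = S i"
    unfolding S_def by (rule sum.reindex_bij_witness[of _ int nat]) auto
  ultimately show ?thesis by simp
qed

text \<open>A polynomial in two variables of degree less than \<open>2 (p - 1)\<close> sums to \<open>0\<close> modulo \<open>p\<close> over the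
  plane, stated for monomials times products of affine linear forms.\<close>

lemma sum_prod_linear_dvd:
  fixes a b c :: "'a \<Rightarrow> int"
  assumes p: "prime p" and "finite T" "i + j + card T < 2 * (p - 1)"
  shows "int p dvd (\<Sum>u\<in>{0..<int p}. \<Sum>v\<in>{0..<int p}.
           u ^ i * v ^ j * (\<Prod>t\<in>T. a t + b t * u + c t * v))"
  using assms(2,3)
proof (induction T arbitrary: i j rule: finite_induct)
  case empty
  let ?I = "{0..<int p}"
  have "(\<Sum>u\<in>?I. \<Sum>v\<in>?I. u ^ i * v ^ j) = (\<Sum>u\<in>?I. u ^ i) * (\<Sum>v\<in>?I. v ^ j)"
    by (simp add: sum_product)
  moreover have "i < p - 1 \<or> j < p - 1" using empty by auto
  ultimately show ?case
    using sum_powers_dvd[OF p, of i] sum_powers_dvd[OF p, of j] by auto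
next
  case (insert t T)
  let ?I = "{0..<int p}"
  let ?S = "\<lambda>i j. \<Sum>u\<in>?I. \<Sum>v\<in>?I. u ^ i * v ^ j * (\<Prod>t\<in>T. a t + b t * u + c t * v)"
  have "(\<Sum>u\<in>?I. \<Sum>v\<in>?I. u ^ i * v ^ j * (\<Prod>t\<in>insert t T. a t + b t * u + c t * v))
      = a t * ?S i j + b t * ?S (Suc i) j + c t * ?S i (Suc j)"
    unfolding sum_distrib_left sum.distrib[symmetric] prod.insert[OF insert.hyps]
    by (intro sum.cong refl) (simp add: algebra_simps)
  moreover have "int p dvd ?S i j" "int p dvd ?S (Suc i) j" "int p dvd ?S i (Suc j)"
    using insert.prems insert.hyps by (intro insert.IH; simp)+
  then have "int p dvd a t * ?S i j + b t * ?S (Suc i) j + c t * ?S i (Suc j)"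
    by (intro dvd_add dvd_mult)
  ultimately show ?case by (simp only:)
qed

text \<open>
  Jamison, and Brouwer and Schrijver. For a point \<open>(x0, y0)\<close> of a set \<open>T\<close> that meets every line, the
  polynomial \<open>\<phi>\<close> below, a product of \<open>card T - 1\<close> affine linear forms in \<open>(u, v)\<close>, is \<open>1\<close> at the
  origin and \<open>0\<close> elsewhere modulo \<open>p\<close>. So it does not sum to \<open>0\<close> over the plane.
\<close>

theorem affine_blocking_set_card:
  fixes T :: "(int \<times> int) set"
  assumes p: "prime p" and fin: "finite T"
    and block: "\<And>u v c. \<not> (int p dvd u \<and> int p dvd v) \<Longrightarrow>
      \<exists>(x, y)\<in>T. [u * x + v * y = c] (mod int p)"
  shows "card T \<ge> 2 * p - 1"
proof (rule ccontr)
  assume *: "\<not> ?thesis"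
  have p1: "p > 1" using p prime_gt_1_nat by blast
  have "\<not> int p dvd 1" using p1 by auto
  then obtain x0 y0 where z0: "(x0, y0) \<in> T"
    using block[of 1 0 0] by auto
  define T' where "T' = T - {(x0, y0)}"
  have card': "card T' < 2 * (p - 1)"
    using * z0 fin p1 by (simp add: T'_def)
  define \<phi> where "\<phi> = (\<lambda>u v. \<Prod>t\<in>T'. 1 + (x0 - fst t) * u + (y0 - snd t) * v)"
  let ?I = "{0..<int p}"
  have zero: "int p dvd \<phi> u v" if uv: "u \<in> ?I" "v \<in> ?I" "(u, v) \<noteq> (0, 0)" for u v
  proof -
    have "\<not> (int p dvd u \<and> int p dvd v)"
      using uv by (auto dest: zdvd_imp_le)
    from block[OF this, of "u * x0 + v * y0 + 1"] obtain x y
      where xy: "(x, y) \<in> T" "[u * x + v * y = u * x0 + v * y0 + 1] (mod int p)" by auto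
    have d: "int p dvd 1 + (x0 - x) * u + (y0 - y) * v"
      using xy(2) by (subst (asm) cong_sym_eq) (simp add: cong_iff_dvd_diff algebra_simps)
    have "(x, y) \<noteq> (x0, y0)" using d \<open>\<not> int p dvd 1\<close> by auto
    then have "(x, y) \<in> T'" using xy by (simp add: T'_def)
    then have "1 + (x0 - x) * u + (y0 - y) * v dvd \<phi> u v"
      unfolding \<phi>_def using fin dvd_prodI[of T' "(x, y)"] by (force simp: T'_def)
    with d show ?thesis by (rule dvd_trans)
  qed
  have "(\<Sum>u\<in>?I. \<Sum>v\<in>?I. \<phi> u v) = (\<Sum>(u, v)\<in>?I \<times> ?I. \<phi> u v)"
    by (simp add: sum.cartesian_product)
  also have "\<dots> = \<phi> 0 0 + (\<Sum>(u, v)\<in>?I \<times> ?I - {(0, 0)}. \<phi> u v)"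
    using p1 by (subst sum.remove[of _ "(0, 0)"]) auto
  finally have eq: "(\<Sum>u\<in>?I. \<Sum>v\<in>?I. \<phi> u v) = 1 + (\<Sum>(u, v)\<in>?I \<times> ?I - {(0, 0)}. \<phi> u v)"
    by (simp add: \<phi>_def)
  have "int p dvd (\<Sum>(u, v)\<in>?I \<times> ?I - {(0, 0)}. \<phi> u v)"
    using zero by (intro dvd_sum) fastforce
  moreover have "int p dvd (\<Sum>u\<in>?I. \<Sum>v\<in>?I. \<phi> u v)"
    using sum_prod_linear_dvd[OF p, of T' 0 0 "\<lambda>_. 1" "\<lambda>t. x0 - fst t" "\<lambda>t. y0 - snd t"] card' fin
    by (simp add: \<phi>_def T'_def)
  ultimately have "int p dvd 1" by (simp add: eq dvd_add_left_iff)
  with \<open>\<not> int p dvd 1\<close> show False by simp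
qed

section \<open>Changing the direction\<close>

text \<open>The linear map of the plane of order \<open>p\<close> with matrix rows \<open>(a, b)\<close> and \<open>(c, d)\<close>. Only
  matrices of determinant \<open>1\<close> are used; they realise every direction \<open>(a, b)\<close> up to scaling.\<close>

definition linear_mod :: "nat \<Rightarrow> int \<Rightarrow> int \<Rightarrow> int \<Rightarrow> int \<Rightarrow> int \<times> int \<Rightarrow> int \<times> int" where
  "linear_mod p a b c d z =
     ((a * fst z + b * snd z) mod int p, (c * fst z + d * snd z) mod int p)"

lemma mod_linear_combination:
  "(a * (x mod m) + b * (y mod m)) mod m = (a * x + b * y) mod (m :: int)"
  by (rule mod_add_cong[OF mod_mult_right_eq mod_mult_right_eq])

lemma linear_mod_inverse:
  assumes det: "a * d - b * c = 1" and z: "z \<in> {0..<int p} \<times> {0..<int p}"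
  shows "linear_mod p d (- b) (- c) a (linear_mod p a b c d z) = z"
proof -
  obtain x y where xy: "z = (x, y)" "0 \<le> x" "x < int p" "0 \<le> y" "y < int p" using z by auto
  have "d * (a * x + b * y) + (- b) * (c * x + d * y) = (a * d - b * c) * x"
    "(- c) * (a * x + b * y) + a * (c * x + d * y) = (a * d - b * c) * y"
    by (simp_all add: algebra_simps)
  then have "d * (a * x + b * y) + (- b) * (c * x + d * y) = x"
    and "(- c) * (a * x + b * y) + a * (c * x + d * y) = y" by (simp_all only: det mult_1)
  then show ?thesis
    unfolding linear_mod_def fst_conv snd_conv mod_linear_combination xy(1) using xy by simp
qed

lemma bij_betw_linear_mod:
  assumes p: "p > 0" and det: "a * d - b * c = 1"
  defines "Z \<equiv> {0..<int p} \<times> {0..<int p}"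
  shows "bij_betw (linear_mod p a b c d) Z Z"
proof (rule bij_betw_byWitness[where f' = "linear_mod p d (- b) (- c) a"])
  show "\<forall>z\<in>Z. linear_mod p d (- b) (- c) a (linear_mod p a b c d z) = z"
    using linear_mod_inverse[OF det] by (simp add: Z_def)
  show "\<forall>z\<in>Z. linear_mod p a b c d (linear_mod p d (- b) (- c) a z) = z"
    using linear_mod_inverse[of d a "- b" "- c"] det by (simp add: Z_def mult.commute)
qed (use p in \<open>auto simp: Z_def linear_mod_def\<close>)

lemma card_linear_mod:
  assumes p: "p > 0" and det: "a * d - b * c = 1"
  defines "Z \<equiv> {0..<int p} \<times> {0..<int p}"
  shows "card {z\<in>Z. Q (linear_mod p a b c d z)} = card {z\<in>Z. Q z}"
proof -
  have b: "bij_betw (linear_mod p a b c d) Z Z"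
    unfolding Z_def by (rule bij_betw_linear_mod[OF p det])
  have "bij_betw (linear_mod p a b c d) {z\<in>Z. Q (linear_mod p a b c d z)} {z\<in>Z. Q z}"
    unfolding bij_betw_def
  proof
    show "inj_on (linear_mod p a b c d) {z\<in>Z. Q (linear_mod p a b c d z)}"
      using b by (auto simp: bij_betw_def inj_on_def)
    have "linear_mod p a b c d ` {z\<in>Z. Q (linear_mod p a b c d z)}
        = {z\<in>linear_mod p a b c d ` Z. Q z}" by blast
    then show "linear_mod p a b c d ` {z\<in>Z. Q (linear_mod p a b c d z)} = {z\<in>Z. Q z}"
      using b by (simp add: bij_betw_def)
  qed
  then show ?thesis by (rule bij_betw_same_card)
qed

lemma card_line:
  assumes p: "p > 0" and det: "a * d - b * c = 1" and m: "m \<in> {0..<int p}"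
  shows "card {(x, y)\<in>{0..<int p} \<times> {0..<int p}. (a * x + b * y) mod int p = m} = p"
proof -
  let ?I = "{0..<int p}"
  have "{(x, y)\<in>?I \<times> ?I. (a * x + b * y) mod int p = m}
      = {z\<in>?I \<times> ?I. fst (linear_mod p a b c d z) = m}"
    by (auto simp: linear_mod_def)
  also have "card \<dots> = card {z\<in>?I \<times> ?I. fst z = m}"
    by (rule card_linear_mod[OF p det])
  also have "{z\<in>?I \<times> ?I. fst z = m} = {m} \<times> ?I" using m by auto
  finally show ?thesis by simp
qed

lemma dft2_cong:
  assumes p: "p > 0" and "[s = s'] (mod int p)" "[t = t'] (mod int p)"
  shows "dft2 p F s t = dft2 p F s' t'"
  unfolding dft2_def
proof (intro sum.cong refl arg_cong2[where f = "(*)"] unity_root_cong p)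
  fix x y
  have "[s * x + t * y = s' * x + t' * y] (mod int p)"
    by (intro cong_add cong_mult cong_refl assms)
  then show "[- (s * x + t * y) = - (s' * x + t' * y)] (mod int p)"
    by (simp only: cong_minus_minus_iff)
qed

text \<open>Composing with the inverse of a linear map composes the transform with the transposed map.\<close>

lemma dft2_linear_mod:
  assumes p: "p > 0" and det: "a * d - b * c = 1"
  shows "dft2 p (\<lambda>x y. case linear_mod p d (- b) (- c) a (x, y) of (x', y') \<Rightarrow> F x' y') s t
     = dft2 p F (a * s + c * t) (b * s + d * t)"
proof -
  let ?Z = "{0..<int p} \<times> {0..<int p}"
  let ?M = "linear_mod p a b c d" and ?N = "linear_mod p d (- b) (- c) a"
  let ?e = "\<lambda>z. unity_root p (- (s * fst z + t * snd z))"
  have "dft2 p (\<lambda>x y. case ?N (x, y) of (x', y') \<Rightarrow> F x' y') s t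
      = (\<Sum>z\<in>?Z. (case ?N z of (x', y') \<Rightarrow> F x' y') * ?e z)"
    unfolding dft2_def by (simp add: sum.cartesian_product case_prod_beta)
  also have "\<dots> = (\<Sum>z\<in>?Z. (case ?N (?M z) of (x', y') \<Rightarrow> F x' y') * ?e (?M z))"
    by (rule sum.reindex_bij_betw[OF bij_betw_linear_mod[OF p det], symmetric])
  also have "\<dots> = (\<Sum>z\<in>?Z. F (fst z) (snd z) *
      unity_root p (- ((a * s + c * t) * fst z + (b * s + d * t) * snd z)))"
  proof (intro sum.cong refl arg_cong2[where f = "(*)"])
    fix z assume z: "z \<in> ?Z"
    show "(case ?N (?M z) of (x', y') \<Rightarrow> F x' y') = F (fst z) (snd z)"
      by (simp add: linear_mod_inverse[OF det z] case_prod_beta)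
    have "[s * fst (?M z) + t * snd (?M z)
        = s * (a * fst z + b * snd z) + t * (c * fst z + d * snd z)] (mod int p)"
      unfolding cong_def linear_mod_def fst_conv snd_conv by (rule mod_linear_combination)
    also have "s * (a * fst z + b * snd z) + t * (c * fst z + d * snd z)
        = (a * s + c * t) * fst z + (b * s + d * t) * snd z" by (simp add: algebra_simps)
    finally show "?e (?M z) = unity_root p (- ((a * s + c * t) * fst z + (b * s + d * t) * snd z))"
      by (intro unity_root_cong p) (simp only: cong_minus_minus_iff)
  qed
  also have "\<dots> = dft2 p F (a * s + c * t) (b * s + d * t)"
    unfolding dft2_def by (simp add: sum.cartesian_product case_prod_beta)
  finally show ?thesis .
qed

text \<open>
  The counting bounds for an arbitrary direction. The lines \<open>a x + b y = m\<close> and the lines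
  \<open>a v - b u = t\<close> have orthogonal directions: they become \<open>x = m\<close> and \<open>v = t\<close> after the change
  of coordinates with rows \<open>(a, b)\<close> and \<open>(c, d)\<close>.
\<close>

lemma direction_count_bounds:
  fixes F :: "int \<Rightarrow> int \<Rightarrow> complex"
  assumes p: "prime p" and det: "a * d - b * c = 1"
  defines "I \<equiv> {0..<int p}"
  defines "n \<equiv> card {m\<in>I. \<exists>(x, y)\<in>I \<times> I. F x y \<noteq> 0 \<and> (a * x + b * y) mod int p = m}"
    and "k \<equiv> card {t\<in>I. \<exists>(u, v)\<in>I \<times> I. dft2 p F u v \<noteq> 0 \<and> (a * v - b * u) mod int p = t}"
  shows "card {(x, y)\<in>I \<times> I. F x y \<noteq> 0} \<ge> n * (p + 1 - k)"
    and "card {(u, v)\<in>I \<times> I. dft2 p F u v \<noteq> 0} \<ge> k * (p + 1 - n)"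
proof -
  have p0: "p > 0" using p prime_gt_0_nat by blast
  let ?M = "linear_mod p a b c d" and ?N = "linear_mod p d (- b) (- c) a"
    and ?L = "linear_mod p a c b d" and ?K = "linear_mod p d (- c) (- b) a"
  define F' where "F' = (\<lambda>x y. case ?N (x, y) of (x', y') \<Rightarrow> F x' y')"
  have detN: "d * a - (- b) * (- c) = 1" and detL: "a * d - c * b = 1" 
    and detK: "d * a - (- c) * (- b) = 1" using det by (simp_all add: mult.commute)
  have MN: "?M (?N z) = z" if "z \<in> I \<times> I" for z
    using linear_mod_inverse[OF detN, of z p] that by (simp add: I_def)
  have NM: "?N (?M z) = z" if "z \<in> I \<times> I" for z
    using linear_mod_inverse[OF det, of z p] that by (simp add: I_def)
  have LK: "?L (?K z) = z" if "z \<in> I \<times> I" for z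
    using linear_mod_inverse[OF detK, of z p] that by (simp add: I_def)
  have KL: "?K (?L z) = z" if "z \<in> I \<times> I" for z
    using linear_mod_inverse[OF detL, of z p] that by (simp add: I_def)
  have mem: "linear_mod p a' b' c' d' z \<in> I \<times> I" for a' b' c' d' z
    using p0 by (simp add: linear_mod_def I_def)
  have dft: "dft2 p F' s t = (case ?L (s, t) of (u, v) \<Rightarrow> dft2 p F u v)" for s t
    unfolding F'_def dft2_linear_mod[OF p0 det]
    by (simp add: linear_mod_def) (rule dft2_cong[OF p0], simp_all add: cong_def)
  have n: "card {x\<in>I. \<exists>y\<in>I. F' x y \<noteq> 0} = n"
    unfolding n_def
  proof (rule arg_cong[where f = card], intro Collect_cong conj_cong refl iffI)
    fix m assume m: "m \<in> I" and "\<exists>y\<in>I. F' m y \<noteq> 0"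
    then obtain y where y: "y \<in> I" "F' m y \<noteq> 0" by blast
    define z where "z = ?N (m, y)"
    have "z \<in> I \<times> I" unfolding z_def by (rule mem)
    moreover have "F (fst z) (snd z) \<noteq> 0" using y by (simp add: F'_def z_def case_prod_beta)
    moreover have "?M z = (m, y)" unfolding z_def using m y by (intro MN) auto
    then have "(a * fst z + b * snd z) mod int p = m" by (simp add: linear_mod_def)
    ultimately show "\<exists>(x, y)\<in>I \<times> I. F x y \<noteq> 0 \<and> (a * x + b * y) mod int p = m"
      by (intro bexI[of _ z]) (simp_all add: case_prod_beta)
  next
    fix m assume "\<exists>(x, y)\<in>I \<times> I. F x y \<noteq> 0 \<and> (a * x + b * y) mod int p = m"
    then obtain x y where xy: "(x, y) \<in> I \<times> I" "F x y \<noteq> 0" "(a * x + b * y) mod int p = m" by auto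
    have "fst (?M (x, y)) = m" using xy by (simp add: linear_mod_def)
    then have "F' m (snd (?M (x, y))) = F x y"
      using NM[OF xy(1)] unfolding F'_def by (metis case_prod_conv prod.collapse)
    then show "\<exists>y\<in>I. F' m y \<noteq> 0" using xy(2) mem[of a b c d "(x, y)"] by (metis mem_Times_iff)
  qed
  have k: "card {t\<in>I. \<exists>s\<in>I. dft2 p F' s t \<noteq> 0} = k"
    unfolding k_def
  proof (rule arg_cong[where f = card], intro Collect_cong conj_cong refl iffI)
    fix t assume t: "t \<in> I" and "\<exists>s\<in>I. dft2 p F' s t \<noteq> 0"
    then obtain s where s: "s \<in> I" "dft2 p F' s t \<noteq> 0" by blast
    define z where "z = ?L (s, t)"
    have "z \<in> I \<times> I" unfolding z_def by (rule mem)
    moreover have "dft2 p F (fst z) (snd z) \<noteq> 0" using s by (simp add: dft z_def case_prod_beta)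
    moreover have "?K z = (s, t)" unfolding z_def using t s by (intro KL) auto
    then have "(a * snd z - b * fst z) mod int p = t" by (simp add: linear_mod_def algebra_simps)
    ultimately show "\<exists>(u, v)\<in>I \<times> I. dft2 p F u v \<noteq> 0 \<and> (a * v - b * u) mod int p = t"
      by (intro bexI[of _ z]) (simp_all add: case_prod_beta)
  next
    fix t assume "\<exists>(u, v)\<in>I \<times> I. dft2 p F u v \<noteq> 0 \<and> (a * v - b * u) mod int p = t"
    then obtain u v where uv: "(u, v) \<in> I \<times> I" "dft2 p F u v \<noteq> 0" "(a * v - b * u) mod int p = t"
      by auto
    have "snd (?K (u, v)) = t" using uv by (simp add: linear_mod_def algebra_simps)
    then have "dft2 p F' (fst (?K (u, v))) t = dft2 p F u v"
      using LK[OF uv(1)] unfolding dft by (metis case_prod_conv prod.collapse)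
    then show "\<exists>s\<in>I. dft2 p F' s t \<noteq> 0"
      using uv(2) mem[of d "- c" "- b" a "(u, v)"] by (metis mem_Times_iff)
  qed
  have "{(x, y)\<in>I \<times> I. F' x y \<noteq> 0} = {z\<in>I \<times> I. case ?N z of (x, y) \<Rightarrow> F x y \<noteq> 0}"
    "{(x, y)\<in>I \<times> I. F x y \<noteq> 0} = {z\<in>I \<times> I. case z of (x, y) \<Rightarrow> F x y \<noteq> 0}"
    by (auto simp: F'_def)
  then have S: "card {(x, y)\<in>I \<times> I. F' x y \<noteq> 0} = card {(x, y)\<in>I \<times> I. F x y \<noteq> 0}"
    using card_linear_mod[OF p0 detN, of "\<lambda>(x, y). F x y \<noteq> 0"] unfolding I_def[symmetric]
    by (simp only:)
  have "{(s, t)\<in>I \<times> I. dft2 p F' s t \<noteq> 0} = {z\<in>I \<times> I. case ?L z of (u, v) \<Rightarrow> dft2 p F u v \<noteq> 0}"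
    "{(u, v)\<in>I \<times> I. dft2 p F u v \<noteq> 0} = {z\<in>I \<times> I. case z of (u, v) \<Rightarrow> dft2 p F u v \<noteq> 0}"
    by (auto simp: dft)
  then have X: "card {(s, t)\<in>I \<times> I. dft2 p F' s t \<noteq> 0} = card {(u, v)\<in>I \<times> I. dft2 p F u v \<noteq> 0}"
    using card_linear_mod[OF p0 detL, of "\<lambda>(u, v). dft2 p F u v \<noteq> 0"] unfolding I_def[symmetric]
    by (simp only:)
  from line_count_bounds[OF p, of F', folded I_def] show
    "card {(x, y)\<in>I \<times> I. F x y \<noteq> 0} \<ge> n * (p + 1 - k)"
    "card {(u, v)\<in>I \<times> I. dft2 p F u v \<noteq> 0} \<ge> k * (p + 1 - n)"
    unfolding n k S X .
qed

text \<open>Up to scaling, every line has an equation \<open>x + b y = m\<close> or \<open>y = m\<close>.\<close>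

lemma blocking_of_slopes:
  fixes T :: "(int \<times> int) set"
  assumes p: "prime p"
    and slope: "\<And>b m. \<exists>(x, y)\<in>T. [x + b * y = m] (mod int p)"
    and horiz: "\<And>m. \<exists>(x, y)\<in>T. [y = m] (mod int p)"
    and uv: "\<not> (int p dvd u \<and> int p dvd v)"
  shows "\<exists>(x, y)\<in>T. [u * x + v * y = c] (mod int p)"
proof -
  have inv: "\<exists>i. [w * i = 1] (mod int p)" if "\<not> int p dvd w" for w
    using that p by (intro cong_solve_coprime_int)
      (metis coprime_commute prime_imp_coprime prime_nat_int_transfer)
  show ?thesis
  proof (cases "int p dvd u")
    case False
    then obtain i where i: "[u * i = 1] (mod int p)" using inv by blast
    obtain x y where xy: "(x, y) \<in> T" "[x + (i * v) * y = i * c] (mod int p)"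
      using slope[of "i * v" "i * c"] by auto
    have "[u * x + (u * i) * (v * y) = (u * i) * c] (mod int p)"
      using cong_scalar_left[OF xy(2), of u] by (simp add: algebra_simps)
    moreover have "[u * x + (u * i) * (v * y) = u * x + 1 * (v * y)] (mod int p)"
      "[(u * i) * c = 1 * c] (mod int p)"
      by (intro cong_add cong_mult i cong_refl)+
    ultimately have "[u * x + v * y = c] (mod int p)"
      by (metis cong_sym cong_trans mult_1)
    then show ?thesis using xy by blast
  next
    case True
    with uv obtain i where i: "[v * i = 1] (mod int p)" using inv by blast
    obtain x y where xy: "(x, y) \<in> T" "[y = i * c] (mod int p)"
      using horiz[of "i * c"] by auto
    have "[u * x + v * y = 0 + (v * i) * c] (mod int p)"
      using True xy(2) by (intro cong_add) (auto simp: cong_0_iff mult.assoc intro: cong_scalar_left)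
    also have "[0 + (v * i) * c = 0 + 1 * c] (mod int p)"
      by (intro cong_add cong_mult i cong_refl)
    finally show ?thesis using xy(1) by auto
  qed
qed

section \<open>The uncertainty inequality in coordinates\<close>

text \<open>If the inequality fails, then the supports are lines of orthogonal directions.\<close>
theorem uncertainty_plane:
  fixes F :: "int \<Rightarrow> int \<Rightarrow> complex"
  assumes p: "prime p" "p \<ge> 3"
  defines "I \<equiv> {0..<int p}"
  defines "S \<equiv> {(x, y)\<in>I \<times> I. F x y \<noteq> 0}" and "X \<equiv> {(u, v)\<in>I \<times> I. dft2 p F u v \<noteq> 0}"
  assumes nz: "S \<noteq> {}"
    and small: "real (card S) / (real p - 1) + real (card X) / 2 < real p + 1"
      "real (card X) / (real p - 1) + real (card S) / 2 < real p + 1"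
  obtains a b c d m t where "a * d - b * c = 1" "m \<in> I" "t \<in> I"
    "S = {(x, y)\<in>I \<times> I. (a * x + b * y) mod int p = m}"
    "X = {(u, v)\<in>I \<times> I. (a * v - b * u) mod int p = t}"
proof -
  have p0: "p > 0" using p by simp
  have fin: "finite I" "finite S" "finite X"
    unfolding S_def X_def I_def by (auto intro: finite_subset[of _ "{0..<int p} \<times> {0..<int p}"])
  have cardI: "card I = p" by (simp add: I_def)
  have modI: "r mod int p \<in> I" for r using p0 by (simp add: I_def)
  have "X \<noteq> {}"
  proof -
    obtain x y where "x \<in> I" "y \<in> I" "F x y \<noteq> 0" using nz by (auto simp: S_def)
    then obtain s t where "s \<in> I" "t \<in> I" "dft2 p F s t \<noteq> 0"
      using dft2_nonzero[OF p(1), of x y F] unfolding I_def by blast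
    then show ?thesis by (auto simp: X_def)
  qed
  define n where "n = (\<lambda>a b. card {m\<in>I. \<exists>(x, y)\<in>S. (a * x + b * y) mod int p = m})"
  define k where "k = (\<lambda>a b. card {t\<in>I. \<exists>(u, v)\<in>X. (a * v - b * u) mod int p = t})"
  have bounds: "n a b * (p + 1 - k a b) \<le> card S" "k a b * (p + 1 - n a b) \<le> card X"
    if "a * d - b * c = 1" for a b c d
  proof -
    have "{m\<in>I. \<exists>(x, y)\<in>S. (a * x + b * y) mod int p = m}
        = {m\<in>I. \<exists>(x, y)\<in>I \<times> I. F x y \<noteq> 0 \<and> (a * x + b * y) mod int p = m}"
      "{t\<in>I. \<exists>(u, v)\<in>X. (a * v - b * u) mod int p = t}
        = {t\<in>I. \<exists>(u, v)\<in>I \<times> I. dft2 p F u v \<noteq> 0 \<and> (a * v - b * u) mod int p = t}"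
      unfolding S_def X_def by blast+
    then show "n a b * (p + 1 - k a b) \<le> card S" "k a b * (p + 1 - n a b) \<le> card X"
      using direction_count_bounds[OF p(1) that, of F, folded I_def]
      unfolding n_def k_def S_def X_def by (simp_all only:)
  qed
  have le: "n a b \<le> p" "k a b \<le> p" for a b
    unfolding n_def k_def cardI[symmetric] using fin by (auto intro!: card_mono)
  have ge: "1 \<le> n a b" "1 \<le> k a b" for a b
  proof -
    obtain x y u v where "(x, y) \<in> S" "(u, v) \<in> X" using nz \<open>X \<noteq> {}\<close> by auto
    then have "(a * x + b * y) mod int p \<in> {m\<in>I. \<exists>(x, y)\<in>S. (a * x + b * y) mod int p = m}"
      "(a * v - b * u) mod int p \<in> {t\<in>I. \<exists>(u, v)\<in>X. (a * v - b * u) mod int p = t}"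
      using modI by blast+
    then have "n a b \<noteq> 0" "k a b \<noteq> 0"
      unfolding n_def k_def using fin by (auto simp: card_eq_0_iff)
    then show "1 \<le> n a b" "1 \<le> k a b" by simp_all
  qed
  note dich = direction_dichotomy[OF p(2) ge(1) le(1) ge(2) le(2) bounds small]
  show ?thesis
  proof (cases "\<exists>a b c d. a * d - b * c = 1 \<and> n a b = 1 \<and> k a b = 1")
    case True
    then obtain a b c d where det: "a * d - b * c = 1" and 1: "n a b = 1" "k a b = 1" by blast
    obtain m where m: "{m\<in>I. \<exists>(x, y)\<in>S. (a * x + b * y) mod int p = m} = {m}"
      using 1(1) unfolding n_def by (auto simp: card_1_singleton_iff)
    obtain t where t: "{t\<in>I. \<exists>(u, v)\<in>X. (a * v - b * u) mod int p = t} = {t}"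
      using 1(2) unfolding k_def by (auto simp: card_1_singleton_iff)
    have mI: "m \<in> I" and tI: "t \<in> I" using m t by blast+
    have "p \<le> card S" "p \<le> card X" using bounds[OF det] unfolding 1 by simp_all
    let ?L = "{(x, y)\<in>I \<times> I. (a * x + b * y) mod int p = m}"
    let ?K = "{(u, v)\<in>I \<times> I. (a * v - b * u) mod int p = t}"
    have finL: "finite ?L" "finite ?K"
      using fin(1) by (auto intro: finite_subset[of _ "I \<times> I"])
    have "card ?L = p"
      unfolding I_def by (rule card_line[OF p0 det]) (use mI in \<open>simp add: I_def\<close>)
    moreover have "S \<subseteq> ?L"
    proof
      fix z assume z: "z \<in> S"
      then have "(a * fst z + b * snd z) mod int p \<in> {m}"
        unfolding m[symmetric] using modI by (auto simp: case_prod_beta)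
      then show "z \<in> ?L" using z by (auto simp: S_def)
    qed
    ultimately have "S = ?L"
      using \<open>p \<le> card S\<close> by (intro card_seteq[OF finL(1)]) (simp_all only:)
    have "{(u, v)\<in>I \<times> I. ((- b) * u + a * v) mod int p = t} = ?K" by (simp add: algebra_simps)
    moreover have "card {(u, v)\<in>I \<times> I. ((- b) * u + a * v) mod int p = t} = p"
      unfolding I_def
      by (rule card_line[OF p0, of _ c _ "- d"]) (use det tI in \<open>simp_all add: I_def mult.commute\<close>)
    ultimately have "card ?K = p" by simp
    moreover have "X \<subseteq> ?K"
    proof
      fix z assume z: "z \<in> X"
      then have "(a * snd z - b * fst z) mod int p \<in> {t}"
        unfolding t[symmetric] using modI by (auto simp: case_prod_beta)
      then show "z \<in> ?K" using z by (auto simp: X_def)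
    qed
    ultimately have "X = ?K"
      using \<open>p \<le> card X\<close> by (intro card_seteq[OF finL(2)]) (simp_all only:)
    show ?thesis by (rule that[OF det mI tI \<open>S = ?L\<close> \<open>X = ?K\<close>])
  next
    case False
    have meet: "\<exists>(x, y)\<in>S. [a * x + b * y = m] (mod int p)"
      "\<exists>(u, v)\<in>X. [a * v - b * u = m] (mod int p)"
      if det: "a * d - b * c = 1" for a b c d m
    proof -
      have np: "n a b = p" "k a b = p" using dich(1)[OF det] False det by blast+
      have "{m\<in>I. \<exists>(x, y)\<in>S. (a * x + b * y) mod int p = m} = I"
        using fin np(1) cardI unfolding n_def by (intro card_subset_eq) auto
      moreover have "{t\<in>I. \<exists>(u, v)\<in>X. (a * v - b * u) mod int p = t} = I"
        using fin np(2) cardI unfolding k_def by (intro card_subset_eq) auto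
      ultimately show "\<exists>(x, y)\<in>S. [a * x + b * y = m] (mod int p)"
        "\<exists>(u, v)\<in>X. [a * v - b * u = m] (mod int p)"
        using modI[of m] unfolding cong_def by blast+
    qed
    \<comment> \<open>the matrices with rows \<open>(1, b), (0, 1)\<close> and \<open>(0, 1), (- 1, 0)\<close> realise all directions\<close>
    have "card S \<ge> 2 * p - 1"
    proof (rule affine_blocking_set_card[OF p(1) fin(2)], rule blocking_of_slopes[OF p(1)])
      show "\<exists>(x, y)\<in>S. [x + b * y = m] (mod int p)" for b m
        using meet(1)[of 1 1 b 0 m] by simp
      show "\<exists>(x, y)\<in>S. [y = m] (mod int p)" for m
        using meet(1)[of 0 0 1 "- 1" m] by simp
    qed
    \<comment> \<open>swapping the coordinates brings the dual lines \<open>v - b u = t\<close> to the required form\<close>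
    moreover have "card (prod.swap ` X) \<ge> 2 * p - 1"
    proof (rule affine_blocking_set_card[OF p(1)], simp add: fin, rule blocking_of_slopes[OF p(1)])
      show "\<exists>(x, y)\<in>prod.swap ` X. [x + b * y = m] (mod int p)" for b m
        using meet(2)[of 1 1 "- b" 0 m] by (auto simp: case_prod_beta)
      show "\<exists>(x, y)\<in>prod.swap ` X. [y = m] (mod int p)" for m
        using meet(2)[of 0 0 1 "- 1" "- m"] by (auto simp: case_prod_beta cong_minus_minus_iff)
    qed
    then have "card X \<ge> 2 * p - 1"
      by (simp add: card_image)
    ultimately have False
      using dich(2)[of 1 1 0 0] p by simp
    then show ?thesis ..
  qed
qed

section \<open>The group and its characters\<close>

lemma carrier_Fp2: "carrier (Fp2 p) = {0..<int p} \<times> {0..<int p}"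
  by (auto simp: Fp2_def residue_ring_def)

lemma one_Fp2: "\<one>\<^bsub>Fp2 p\<^esub> = (0, 0)"
  by (simp add: Fp2_def residue_ring_def)

lemma mult_Fp2: "z \<otimes>\<^bsub>Fp2 p\<^esub> w = ((fst z + fst w) mod int p, (snd z + snd w) mod int p)"
  by (cases z; cases w) (simp add: Fp2_def residue_ring_def)

lemma inv_Fp2:
  assumes p: "prime p" and z: "z \<in> carrier (Fp2 p)"
  shows "inv\<^bsub>Fp2 p\<^esub> z = ((- fst z) mod int p, (- snd z) mod int p)"
proof -
  interpret comm_group "Fp2 p" by (rule comm_group_Fp2[OF p])
  have "p > 0" using p prime_gt_0_nat by blast
  then show ?thesis
    by (intro inv_equality z) (auto simp: mult_Fp2 one_Fp2 carrier_Fp2 mod_simps)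
qed

text \<open>The character of the plane of order \<open>p\<close> attached to the coordinate vector \<open>w\<close>.\<close>

definition Fp2_char :: "nat \<Rightarrow> int \<times> int \<Rightarrow> int \<times> int \<Rightarrow> complex" where
  "Fp2_char p w = (\<lambda>z\<in>carrier (Fp2 p). unity_root p (fst w * fst z + snd w * snd z))"

lemma Fp2_char_closed:
  assumes "p > 0"
  shows "Fp2_char p w \<in> carrier (dual_group (Fp2 p))"
proof -
  have "unity_root p (fst w * ((fst z + fst z') mod int p) + snd w * ((snd z + snd z') mod int p))
      = unity_root p (fst w * fst z + snd w * snd z) * unity_root p (fst w * fst z' + snd w * snd z')"
    for z z'
    unfolding unity_root_add[symmetric]
    by (rule unity_root_cong[OF assms])
      (simp add: cong_def mod_linear_combination distrib_left add_ac)
  then show ?thesis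
    using assms
    by (auto simp: dual_group_def hom_def complex_units_def Fp2_char_def mult_Fp2 unity_root_nz carrier_Fp2)
qed

text \<open>The characters of the cyclic group of order \<open>p\<close>.\<close>

lemma cyclic_character:
  assumes p: "p > 0" and nz: "g 0 \<noteq> 0"
    and hom: "\<And>x y. x \<in> {0..<int p} \<Longrightarrow> y \<in> {0..<int p} \<Longrightarrow> g ((x + y) mod int p) = g x * g y"
  obtains u where "u \<in> {0..<int p}" "\<And>x. x \<in> {0..<int p} \<Longrightarrow> g x = unity_root p (u * x)"
proof -
  have "g 0 * g 0 = g 0 * 1" using hom[of 0 0] p by simp
  then have g0: "g 0 = 1" using nz by (metis mult_left_cancel)
  have pow: "g (int n mod int p) = g (1 mod int p) ^ n" for n
  proof (induction n)
    case (Suc n)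
    have "int (Suc n) mod int p = (int n mod int p + 1 mod int p) mod int p"
      by (simp add: mod_simps add.commute)
    then have "g (int (Suc n) mod int p) = g (int n mod int p) * g (1 mod int p)"
      using hom[of "int n mod int p" "1 mod int p"] p by simp
    then show ?case using Suc by simp
  qed (simp add: g0)
  have "g (1 mod int p) ^ p = 1" using pow[of p] g0 by simp
  then obtain u where u: "u \<in> {0..<int p}" "g (1 mod int p) = unity_root p u"
    using roots_of_unity_surj[OF p] by blast
  have "g x = unity_root p (u * x)" if "x \<in> {0..<int p}" for x
    using pow[of "nat x"] that by (simp add: u unity_root_power mult.commute)
  then show ?thesis using that u(1) by blast
qed

text \<open>Every character is \<open>Fp2_char p w\<close> for a unique \<open>w\<close>, which identifies the dual group with the plane.\<close>

lemma Fp2_char_bij: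
  assumes p: "prime p"
  shows "bij_betw (Fp2_char p) ({0..<int p} \<times> {0..<int p}) (carrier (dual_group (Fp2 p)))"
proof -
  let ?I = "{0..<int p}"
  have p0: "p > 0" and p1: "p > 1" using p prime_gt_0_nat prime_gt_1_nat by blast+
  have "inj_on (Fp2_char p) (?I \<times> ?I)"
  proof (rule inj_onI)
    fix w w' assume w: "w \<in> ?I \<times> ?I" "w' \<in> ?I \<times> ?I" and eq: "Fp2_char p w = Fp2_char p w'"
    have "[fst w = fst w'] (mod int p)" "[snd w = snd w'] (mod int p)"
      using fun_cong[OF eq, of "(1, 0)"] fun_cong[OF eq, of "(0, 1)"] p0 p1
      by (simp_all add: Fp2_char_def carrier_Fp2 unity_root_eq_iff)
    then show "w = w'"
      using w by (auto simp: prod_eq_iff cong_less_imp_eq_int)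
  qed
  moreover have "\<psi> \<in> Fp2_char p ` (?I \<times> ?I)" if \<psi>: "\<psi> \<in> carrier (dual_group (Fp2 p))" for \<psi>
  proof -
    have hom: "\<psi> ((x + x') mod int p, (y + y') mod int p) = \<psi> (x, y) * \<psi> (x', y')"
      and nz: "\<psi> (x, y) \<noteq> 0" if "x \<in> ?I" "y \<in> ?I" "x' \<in> ?I" "y' \<in> ?I" for x y x' y'
    proof -
      have "(x, y) \<in> carrier (Fp2 p)" "(x', y') \<in> carrier (Fp2 p)"
        using that by (simp_all add: carrier_Fp2)
      with \<psi> have "\<psi> ((x, y) \<otimes>\<^bsub>Fp2 p\<^esub> (x', y')) = \<psi> (x, y) * \<psi> (x', y')" "\<psi> (x, y) \<noteq> 0"
        by (auto simp: dual_group_def hom_def complex_units_def Pi_iff simp del: mult_DirProd)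
      then show "\<psi> ((x + x') mod int p, (y + y') mod int p) = \<psi> (x, y) * \<psi> (x', y')"
        "\<psi> (x, y) \<noteq> 0" by (simp_all add: mult_Fp2)
    qed
    have 0: "0 \<in> ?I" using p0 by simp
    obtain u where u: "u \<in> ?I" "\<And>x. x \<in> ?I \<Longrightarrow> \<psi> (x, 0) = unity_root p (u * x)"
      using cyclic_character[OF p0, of "\<lambda>x. \<psi> (x, 0)"] nz[OF 0 0 0 0] hom[OF _ 0 _ 0] by auto
    obtain v where v: "v \<in> ?I" "\<And>y. y \<in> ?I \<Longrightarrow> \<psi> (0, y) = unity_root p (v * y)"
      using cyclic_character[OF p0, of "\<lambda>y. \<psi> (0, y)"] nz[OF 0 0 0 0] hom[OF 0 _ 0 _] by auto
    have "\<psi> = Fp2_char p (u, v)"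
    proof (rule extensionalityI[where A = "carrier (Fp2 p)"])
      show "\<psi> \<in> extensional (carrier (Fp2 p))" using \<psi> by (simp add: dual_group_def)
      show "Fp2_char p (u, v) \<in> extensional (carrier (Fp2 p))" by (simp add: Fp2_char_def)
      fix z assume z: "z \<in> carrier (Fp2 p)"
      then obtain x y where xy: "z = (x, y)" "x \<in> ?I" "y \<in> ?I" by (auto simp: carrier_Fp2)
      have "\<psi> z = \<psi> (x, 0) * \<psi> (0, y)" using hom[OF xy(2) 0 0 xy(3)] xy by simp
      then show "\<psi> z = Fp2_char p (u, v) z"
        using z u(2)[OF xy(2)] v(2)[OF xy(3)] by (simp add: Fp2_char_def xy(1) unity_root_add)
    qed
    then show ?thesis using u(1) v(1) by blast
  qed
  ultimately show ?thesis
    using Fp2_char_closed[OF p0] by (auto simp: bij_betw_def)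
qed

lemma fourier_Fp2_char:
  "fourier (Fp2 p) f (Fp2_char p (u, v)) = dft2 p (curry f) u v / of_nat (order (Fp2 p))"
proof -
  have "(\<Sum>g\<in>carrier (Fp2 p). f g * cnj (Fp2_char p (u, v) g))
      = (\<Sum>(x, y)\<in>{0..<int p} \<times> {0..<int p}. f (x, y) * unity_root p (- (u * x + v * y)))"
    by (intro sum.cong) (auto simp: carrier_Fp2 Fp2_char_def cnj_unity_root)
  then show ?thesis
    by (simp add: fourier_def dft2_def sum.cartesian_product)
qed

lemma mult_Fp2_char:
  assumes "p > 0"
  shows "Fp2_char p w \<otimes>\<^bsub>dual_group (Fp2 p)\<^esub> Fp2_char p w'
    = Fp2_char p ((fst w + fst w') mod int p, (snd w + snd w') mod int p)"
proof -
  have "unity_root p (fst w * fst z + snd w * snd z) * unity_root p (fst w' * fst z + snd w' * snd z)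
     = unity_root p (((fst w + fst w') mod int p) * fst z + ((snd w + snd w') mod int p) * snd z)" for z
    unfolding unity_root_add[symmetric]
    by (rule unity_root_cong[OF assms])
      (simp add: cong_def mod_linear_combination mult.commute[of _ "fst z"] mult.commute[of _ "snd z"]
        distrib_left add_ac)
  then show ?thesis
    by (auto simp: dual_group_def Fp2_char_def fun_eq_iff restrict_def)
qed

section \<open>Lines as cosets\<close>

lemma subgroup_line:
  assumes p: "prime p"
  shows "subgroup {(x, y)\<in>carrier (Fp2 p). (a * x + b * y) mod int p = 0} (Fp2 p)"
    (is "subgroup ?H _")
proof -
  interpret comm_group "Fp2 p" by (rule comm_group_Fp2[OF p])
  have p0: "p > 0" using p prime_gt_0_nat by blast
  show ?thesis
  proof (rule subgroupI)
    show "?H \<subseteq> carrier (Fp2 p)" by auto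
    have "(0, 0) \<in> ?H" using p0 by (simp add: carrier_Fp2)
    then show "?H \<noteq> {}" by (metis empty_iff)
  next
    fix z assume z: "z \<in> ?H"
    then have "(a * fst z + b * snd z) mod int p = 0" by auto
    then have "(- (a * fst z + b * snd z)) mod int p = 0"
      by (simp only: mod_eq_0_iff_dvd dvd_minus_iff)
    also have "- (a * fst z + b * snd z) = a * (- fst z) + b * (- snd z)" by simp
    finally show "inv\<^bsub>Fp2 p\<^esub> z \<in> ?H"
      using z inv_Fp2[OF p, of z] inv_closed[of z] by (auto simp: mod_linear_combination)
  next
    fix z w assume z: "z \<in> ?H" "w \<in> ?H"
    then have "int p dvd a * fst z + b * snd z" "int p dvd a * fst w + b * snd w" by auto
    then have "int p dvd (a * fst z + b * snd z) + (a * fst w + b * snd w)"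
      by (rule dvd_add)
    also have "(a * fst z + b * snd z) + (a * fst w + b * snd w)
        = a * (fst z + fst w) + b * (snd z + snd w)" by (simp add: algebra_simps)
    finally have "(a * (fst z + fst w) + b * (snd z + snd w)) mod int p = 0" by simp
    then show "z \<otimes>\<^bsub>Fp2 p\<^esub> w \<in> ?H"
      using z m_closed[of z w] by (auto simp: mult_Fp2 mod_linear_combination)
  qed
qed

lemma line_translate:
  assumes p: "p > 0" and w: "w \<in> {0..<int p} \<times> {0..<int p}"
    and m: "(a * fst w + b * snd w) mod int p = m"
  shows "{(x, y)\<in>{0..<int p} \<times> {0..<int p}. (a * x + b * y) mod int p = m}
    = (\<lambda>z. ((fst z + fst w) mod int p, (snd z + snd w) mod int p)) `
        {(x, y)\<in>{0..<int p} \<times> {0..<int p}. (a * x + b * y) mod int p = 0}"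
    (is "?L = ?f ` ?H")
proof (intro equalityI subsetI)
  fix z assume "z \<in> ?f ` ?H"
  then obtain h where h: "z = ?f h" "h \<in> ?H" by (rule imageE)
  have "(a * fst h + b * snd h) mod int p = 0" using h by auto
  moreover have "(a * (fst h + fst w) + b * (snd h + snd w)) mod int p
      = ((a * fst h + b * snd h) mod int p + (a * fst w + b * snd w)) mod int p"
    unfolding mod_add_left_eq by (simp add: algebra_simps)
  ultimately have "(a * (fst h + fst w) + b * (snd h + snd w)) mod int p = m"
    using m by (simp only: add_0)
  then show "z \<in> ?L" using p by (simp add: h(1) mod_linear_combination)
next
  fix z assume z: "z \<in> ?L"
  define h where "h = ((fst z - fst w) mod int p, (snd z - snd w) mod int p)"
  have "a * (fst z - fst w) + b * (snd z - snd w)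
      = (a * fst z + b * snd z) - (a * fst w + b * snd w)" by (simp add: algebra_simps)
  moreover have "((a * fst z + b * snd z) - (a * fst w + b * snd w)) mod int p = 0"
    using z m by (auto simp: mod_eq_dvd_iff mod_eq_0_iff_dvd)
  ultimately have "h \<in> ?H" using p by (simp add: h_def mod_linear_combination)
  moreover have "z = ?f h" using z by (auto simp: h_def mod_simps)
  ultimately show "z \<in> ?f ` ?H" by (rule rev_image_eqI)
qed

lemma line_in_rcosets:
  assumes p: "prime p" and det: "a * d - b * c = 1" and m: "m \<in> {0..<int p}"
  shows "{(x, y)\<in>{0..<int p} \<times> {0..<int p}. (a * x + b * y) mod int p = m}
    \<in> rcosets\<^bsub>Fp2 p\<^esub> {(x, y)\<in>carrier (Fp2 p). (a * x + b * y) mod int p = 0}"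
proof -
  have p0: "p > 0" using p prime_gt_0_nat by blast
  \<comment> \<open>the point with \<open>a x + b y = m\<close> and \<open>c x + d y = 0\<close>\<close>
  define w where "w = ((d * m) mod int p, (- c * m) mod int p)"
  have w: "w \<in> {0..<int p} \<times> {0..<int p}" using p0 by (simp add: w_def)
  have "a * (d * m) + b * (- c * m) = (a * d - b * c) * m" by (simp add: algebra_simps)
  then have wm: "(a * fst w + b * snd w) mod int p = m"
    using m unfolding w_def fst_conv snd_conv mod_linear_combination det by simp
  show ?thesis
    unfolding RCOSETS_def r_coset_def
    by (rule UN_I[of w])
      (use w line_translate[OF p0 w wm] in \<open>auto simp: carrier_Fp2 mult_Fp2\<close>)
qed

lemma annihilator_line:
  assumes p: "prime p" and det: "a * d - b * c = 1"
  shows "annihilator (Fp2 p) {(x, y)\<in>carrier (Fp2 p). (a * x + b * y) mod int p = 0}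
    = Fp2_char p ` {(u, v)\<in>{0..<int p} \<times> {0..<int p}. (a * v - b * u) mod int p = 0}"
    (is "annihilator _ ?H = Fp2_char p ` ?K")
proof (intro equalityI subsetI)
  have p0: "p > 0" using p prime_gt_0_nat by blast
  let ?I = "{0..<int p}"
  {
    fix \<psi> assume \<psi>: "\<psi> \<in> annihilator (Fp2 p) ?H"
    then have "\<psi> \<in> carrier (dual_group (Fp2 p))" by (simp add: annihilator_def)
    then have "\<psi> \<in> Fp2_char p ` (?I \<times> ?I)"
      using Fp2_char_bij[OF p] by (simp add: bij_betw_def)
    then obtain u v where uv: "u \<in> ?I" "v \<in> ?I" "\<psi> = Fp2_char p (u, v)" by auto
    \<comment> \<open>a generator of the line through the origin\<close>
    define h where "h = ((- b) mod int p, a mod int p)"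
    have "h \<in> ?H"
      using p0 by (simp add: h_def carrier_Fp2 mod_linear_combination)
    then have "\<psi> h = 1" using \<psi> by (auto simp: annihilator_def kernel_def complex_units_def)
    then have "int p dvd u * fst h + v * snd h"
      using \<open>h \<in> ?H\<close> unfolding uv(3) Fp2_char_def by (auto simp: unity_root_eq_1_iff[OF p0])
    then have "(u * (- b) + v * a) mod int p = 0"
      unfolding h_def fst_conv snd_conv by (simp only: mod_eq_0_iff_dvd[symmetric] mod_linear_combination)
    then have "(u, v) \<in> ?K" using uv by (simp add: algebra_simps)
    then show "\<psi> \<in> Fp2_char p ` ?K" unfolding uv(3) by (rule imageI)
  }
  {
    fix \<psi> assume "\<psi> \<in> Fp2_char p ` ?K"
    then obtain u v where uv: "u \<in> ?I" "v \<in> ?I" "(a * v - b * u) mod int p = 0" "\<psi> = Fp2_char p (u, v)"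
      by auto
    have "\<psi> z = 1" if z: "z \<in> ?H" for z
    proof -
      \<comment> \<open>the pairing in the coordinates \<open>a x + b y, c x + d y\<close> and the dual \<open>d u - c v, a v - b u\<close>\<close>
      have "u * fst z + v * snd z = (a * d - b * c) * (u * fst z + v * snd z)" by (simp add: det)
      also have "\<dots> = (d * u - c * v) * (a * fst z + b * snd z)
          + (a * v - b * u) * (c * fst z + d * snd z)" by (simp add: algebra_simps)
      finally have "int p dvd u * fst z + v * snd z"
        using z uv(3) by (auto simp: mod_eq_0_iff_dvd)
      then show ?thesis
        using z unfolding uv(4) Fp2_char_def by (auto simp: unity_root_eq_1_iff[OF p0])
    qed
    then show "\<psi> \<in> annihilator (Fp2 p) ?H"
      using Fp2_char_closed[OF p0, of "(u, v)"] uv(4)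
      by (auto simp: annihilator_def kernel_def complex_units_def)
  }
qed

lemma dual_line_in_rcosets:
  assumes p: "prime p" and det: "a * d - b * c = 1" and t: "t \<in> {0..<int p}"
  shows "Fp2_char p ` {(u, v)\<in>{0..<int p} \<times> {0..<int p}. (a * v - b * u) mod int p = t}
    \<in> rcosets\<^bsub>dual_group (Fp2 p)\<^esub>
        (annihilator (Fp2 p) {(x, y)\<in>carrier (Fp2 p). (a * x + b * y) mod int p = 0})"
proof -
  have p0: "p > 0" using p prime_gt_0_nat by blast
  \<comment> \<open>the dual vector with \<open>a v - b u = t\<close> and \<open>d u - c v = 0\<close>\<close>
  define w where "w = ((c * t) mod int p, (d * t) mod int p)"
  have w: "w \<in> {0..<int p} \<times> {0..<int p}" using p0 by (simp add: w_def)
  have "(- b) * (c * t) + a * (d * t) = (a * d - b * c) * t" by (simp add: algebra_simps)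
  then have wt: "((- b) * fst w + a * snd w) mod int p = t"
    using t unfolding w_def fst_conv snd_conv mod_linear_combination det by simp
  have swap: "{(u, v)\<in>{0..<int p} \<times> {0..<int p}. (a * v - b * u) mod int p = r}
      = {(u, v)\<in>{0..<int p} \<times> {0..<int p}. ((- b) * u + a * v) mod int p = r}" for r
    by (simp add: algebra_simps)
  define K where "K = {(u, v)\<in>{0..<int p} \<times> {0..<int p}. ((- b) * u + a * v) mod int p = 0}"
  have "(\<Union>\<psi>\<in>Fp2_char p ` K. {\<psi> \<otimes>\<^bsub>dual_group (Fp2 p)\<^esub> Fp2_char p w})
      = Fp2_char p ` (\<lambda>z. ((fst z + fst w) mod int p, (snd z + snd w) mod int p)) ` K"
    by (simp add: mult_Fp2_char[OF p0] image_image UNION_singleton_eq_range)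
  then show ?thesis
    unfolding annihilator_line[OF p det] swap line_translate[OF p0 w wt] RCOSETS_def r_coset_def
      K_def[symmetric]
    using Fp2_char_closed[OF p0, of w] by blast
qed

section \<open>The uncertainty inequality\<close>

theorem theorem2:
  fixes p :: nat and f :: "int \<times> int \<Rightarrow> complex"
    and S :: "(int \<times> int) set" and X :: "(int \<times> int \<Rightarrow> complex) set"
  assumes "prime p" and "p \<ge> 3"
    and nonzero: "\<exists>g\<in>carrier (Fp2 p). f g \<noteq> 0"
    and S: "S = support_on (carrier (Fp2 p)) f"
    and X: "X = support_on (carrier (dual_group (Fp2 p))) (fourier (Fp2 p) f)"
    and not_exceptional:
      "\<not> (\<exists>H. subgroup H (Fp2 p) \<and> H \<noteq> {\<one>\<^bsub>Fp2 p\<^esub>} \<and> H \<noteq> carrier (Fp2 p) \<and>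
            S \<in> rcosets\<^bsub>Fp2 p\<^esub> H \<and>
            X \<in> rcosets\<^bsub>dual_group (Fp2 p)\<^esub> (annihilator (Fp2 p) H))"
  shows "1 / (real p - 1) * real (min (card S) (card X)) + 1 / 2 * real (max (card S) (card X))
           \<ge> real p + 1"
proof (rule ccontr)
  let ?I = "{0..<int p}"
  have p: "prime p" "p \<ge> 3" by fact+
  then have p0: "p > 0" and p1: "p > 1" by simp_all
  assume neg: "\<not> ?thesis"
  \<comment> \<open>as \<open>1 / (p - 1) \<le> 1 / 2\<close>, exchanging minimum and maximum does not increase the left-hand side\<close>
  have small: "real (card S) / (real p - 1) + real (card X) / 2 < real p + 1"
    "real (card X) / (real p - 1) + real (card S) / 2 < real p + 1"
  proof -
    define r where "r = 1 / (real p - 1)"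
    have r: "r \<le> 1 / 2" using p by (simp add: r_def field_simps)
    have "r * max s t + min s t / 2 \<le> r * min s t + max s t / 2" for s t :: real
    proof -
      have "0 \<le> (1 / 2 - r) * (max s t - min s t)"
        using r by (intro mult_nonneg_nonneg) auto
      then show ?thesis by (simp add: algebra_simps)
    qed
    note this[of "real (card S)" "real (card X)"]
    moreover have "r * real (min (card S) (card X)) + real (max (card S) (card X)) / 2 < real p + 1"
      using neg by (simp add: r_def)
    ultimately have "r * real (card S) + real (card X) / 2 < real p + 1"
      "r * real (card X) + real (card S) / 2 < real p + 1"
      by (auto simp: min_def max_def split: if_splits)
    then show "real (card S) / (real p - 1) + real (card X) / 2 < real p + 1"
      "real (card X) / (real p - 1) + real (card S) / 2 < real p + 1"
      by (simp_all add: r_def)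
  qed
  have order0: "order (Fp2 p) > 0"
    using p0 by (simp add: order_def carrier_Fp2)
  define X' where "X' = {(u, v)\<in>?I \<times> ?I. dft2 p (curry f) u v \<noteq> 0}"
  have S': "S = {(x, y)\<in>?I \<times> ?I. curry f x y \<noteq> 0}"
    unfolding S by (auto simp: support_on_def carrier_Fp2)
  have X_eq: "X = Fp2_char p ` X'"
  proof -
    have "carrier (dual_group (Fp2 p)) = Fp2_char p ` (?I \<times> ?I)"
      using Fp2_char_bij[OF p(1)] by (simp add: bij_betw_def)
    then show ?thesis
      using order0 unfolding X X'_def support_on_def
      by (auto simp: fourier_Fp2_char)
  qed
  have "inj_on (Fp2_char p) X'"
    using Fp2_char_bij[OF p(1)] by (auto simp: bij_betw_def X'_def intro: inj_on_subset)
  then have cX: "card X = card X'" unfolding X_eq by (rule card_image)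
  have "S \<noteq> {}" using nonzero by (auto simp: S support_on_def)
  obtain a b c d m t where det: "a * d - b * c = 1" and mt: "m \<in> ?I" "t \<in> ?I"
    and SL: "S = {(x, y)\<in>?I \<times> ?I. (a * x + b * y) mod int p = m}"
    and XL: "X' = {(u, v)\<in>?I \<times> ?I. (a * v - b * u) mod int p = t}"
    by (rule uncertainty_plane[OF p, of "curry f", folded S' X'_def,
          OF \<open>S \<noteq> {}\<close> small[unfolded cX]])
  define H where "H = {(x, y)\<in>carrier (Fp2 p). (a * x + b * y) mod int p = 0}"
  have "card H = p"
    unfolding H_def carrier_Fp2 by (rule card_line[OF p0 det]) (use p0 in simp)
  moreover have "card {\<one>\<^bsub>Fp2 p\<^esub>} = 1" "card (carrier (Fp2 p)) = p * p"
    by (simp_all add: carrier_Fp2)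
  moreover have "p \<noteq> 1" "p \<noteq> p * p" using p1 by auto
  ultimately have "H \<noteq> {\<one>\<^bsub>Fp2 p\<^esub>}" "H \<noteq> carrier (Fp2 p)" by metis+
  moreover have "subgroup H (Fp2 p)" unfolding H_def by (rule subgroup_line[OF p(1)])
  moreover have "S \<in> rcosets\<^bsub>Fp2 p\<^esub> H"
    unfolding H_def SL by (rule line_in_rcosets[OF p(1) det mt(1)])
  moreover have "X \<in> rcosets\<^bsub>dual_group (Fp2 p)\<^esub> (annihilator (Fp2 p) H)"
    unfolding H_def X_eq XL by (rule dual_line_in_rcosets[OF p(1) det mt(2)])
  ultimately show False using not_exceptional by blast
qed

end
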